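(* Let $E$ and $E'$ be twists over locally compact Hausdorff groupoids $G$ and $G'$ (with open range and source maps), with quotient maps $j:E\to G$ and $j':E'\to G'$, and let $Z$ be an $(E,E')$-twist equivalence over $(G,G')$. Let $Z_{\mathbf T}=\mathbf T\backslash Z=Z/\mathbf T$ be the quotient space, with $[z]$ the class of $z\in Z$, equipped with the (well-defined) left $G$-action and right $G'$-action $$j(e)\cdot[z]=[e\cdot z],\qquad [z]\cdot j'(e')=[z\cdot e'],$$ whose moment maps are $[z]\mapsto r_Z(z)$ and $[z]\mapsto s_Z(z)$ respectively. Then $Z_{\mathbf T}$ is a $(G,G')$-equivalence. In particular, $G$ and $G'$ are equivalent groupoids.
   Context: Groupoids are locally compact Hausdorff topological groupoids with open range and source maps $r,s$; $G^{(0)}$ is the unit space. $\mathbf T$ is the circle group. Actions: a left action of $G$ on a space $P$ consists of a continuous moment map $r_P:P\to G^{(0)}$ and a continuous map $(\gamma,p)\mapsto\gamma\cdot p$ from $G*P=\{(\gamma,p): s(\gamma)=r_P(p)\}$ to $P$ with $r_P(\gamma\cdot p)=r(\gamma)$, $r_P(p)\cdot p=p$ and $\gamma\cdot(\eta\cdot p)=(\gamma\eta)\cdot p$ for composable $\gamma,\eta$. The action is free if $\gamma\cdot p=p$ only when $\gamma=r_P(p)$. It is proper if the map $(\gamma,p)\mapsto(\gamma\cdot p,p)$ from $G*P$ to $P\times P$ is proper (preimages of compact sets are compact). Right actions are defined similarly, with moment map $s_P$. A $(G,H)$-equivalence is a locally compact Hausdorff space $Z$ such that: (E1) $Z$ is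 a free and proper left $G$-space; (E2) $Z$ is a free and proper right $H$-space; (E3) the two actions commute; (E4) the moment map $r_Z:Z\to G^{(0)}$ is open and induces a homeomorphism $Z/H\to G^{(0)}$; (E5) the moment map $s_Z:Z\to H^{(0)}$ is open and induces a homeomorphism $G\backslash Z\to H^{(0)}$. $G$ and $H$ are equivalent if such a $Z$ exists. A twist $E$ over $G$ is a central groupoid extension $G^{(0)}\times\mathbf T\xrightarrow{\iota}E\xrightarrow{j}G$, where $E$ is a groupoid, $\iota$ and $j$ are continuous groupoid homomorphisms, $\iota$ is a homeomorphism onto its range, $j$ is an open surjection inducing a homeomorphism of $E^{(0)}$ with $G^{(0)}$ (used to identify them, so $\iota(u,1)=u$), the kernel of $j$ is the range of $\iota$, and $\iota(r(e),t)e=e\,\iota(s(e),t)$ for all $e\in E$, $t\in\mathbf T$. If $E$ acts on the left of $Z$, then $\mathbf T$ acts on the left of $Z$ by $t\cdot z=\iota(r_Z(z),t)\cdot z$; if $E'$ (with $\iota'$) acts on the right of $Z$, then $\mathbf T$ acts on the right by $z\cdot t=z\cdot\iota'(s_Z(z),t)$. An $(E,E')$-twist equivalence over $(G,G')$ is an $(E,E')$-equivalence $Z$ such that $t\cdot z=z\cdot t$ for all $t\in\mathbf T$, $z\in Z$. *)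

theory Defs
  imports "HOL-Analysis.Analysis"
begin

section \<open>Quotient topologies\<close>

definition quotient_space :: "'a topology \<Rightarrow> ('a \<Rightarrow> 'b) \<Rightarrow> 'b topology" where
  "quotient_space X q =
     topology (\<lambda>U. U \<subseteq> q ` topspace X \<and> openin X {x \<in> topspace X. q x \<in> U})"

lemma openin_quotient_space:
  "openin (quotient_space X q) U \<longleftrightarrow>
     U \<subseteq> q ` topspace X \<and> openin X {x \<in> topspace X. q x \<in> U}"
proof -
  have "istopology (\<lambda>U. U \<subseteq> q ` topspace X \<and> openin X {x \<in> topspace X. q x \<in> U})"
    unfolding istopology_def
  proof (intro conjI allI impI)
    fix S T
    assume S: "S \<subseteq> q ` topspace X \<and> openin X {x \<in> topspace X. q x \<in> S}"
      and T: "T \<subseteq> q ` topspace X \<and> openin X {x \<in> topspace X. q x \<in> T}"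
    have "{x \<in> topspace X. q x \<in> S \<inter> T} =
        {x \<in> topspace X. q x \<in> S} \<inter> {x \<in> topspace X. q x \<in> T}"
      by blast
    with S T show "openin X {x \<in> topspace X. q x \<in> S \<inter> T}"
      by (simp add: openin_Int)
    from S show "S \<inter> T \<subseteq> q ` topspace X" by blast
  next
    fix \<K>
    assume \<K>: "\<forall>K\<in>\<K>. K \<subseteq> q ` topspace X \<and> openin X {x \<in> topspace X. q x \<in> K}"
    have "{x \<in> topspace X. q x \<in> \<Union>\<K>} = (\<Union>K\<in>\<K>. {x \<in> topspace X. q x \<in> K})"
      by blast
    with \<K> show "openin X {x \<in> topspace X. q x \<in> \<Union>\<K>}"
      by auto
    from \<K> show "\<Union>\<K> \<subseteq> q ` topspace X" by blast
  qed
  then show ?thesis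
    by (simp add: quotient_space_def)
qed

lemma topspace_quotient_space [simp]: "topspace (quotient_space X q) = q ` topspace X"
proof -
  have "{x \<in> topspace X. q x \<in> q ` topspace X} = topspace X" by blast
  then have "openin (quotient_space X q) (q ` topspace X)"
    by (simp add: openin_quotient_space)
  then show ?thesis
    by (metis openin_quotient_space openin_subset openin_topspace subset_antisym)
qed

lemma quotient_map_quotient_space: "quotient_map X (quotient_space X q) q"
  by (simp add: quotient_map_def openin_quotient_space)

section \<open>Topological groupoids\<close>

record 'g groupoid =
  gtop :: "'g topology"
  rng :: "'g \<Rightarrow> 'g"
  src :: "'g \<Rightarrow> 'g"
  mul :: "'g \<Rightarrow> 'g \<Rightarrow> 'g"
  ginv :: "'g \<Rightarrow> 'g"

definition arrows :: "'g groupoid \<Rightarrow> 'g set" where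
  "arrows G = topspace (gtop G)"

definition units :: "'g groupoid \<Rightarrow> 'g set" where
  "units G = rng G ` arrows G"

definition unit_space :: "'g groupoid \<Rightarrow> 'g topology" where
  "unit_space G = subtopology (gtop G) (units G)"

definition composable :: "'g groupoid \<Rightarrow> ('g \<times> 'g) set" where
  "composable G = {(x, y). x \<in> arrows G \<and> y \<in> arrows G \<and> src G x = rng G y}"

text \<open>
  Continuity of the range and source maps follows from that of multiplication and inversion,
  since \<open>rng G x = mul G x (ginv G x)\<close>.
\<close>

locale lch_groupoid =
  fixes G :: "'g groupoid"
  assumes src_units: "x \<in> arrows G \<Longrightarrow> src G x \<in> units G"
    and units_arrows: "u \<in> units G \<Longrightarrow> u \<in> arrows G"
    and rng_unit: "u \<in> units G \<Longrightarrow> rng G u = u"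
    and src_unit: "u \<in> units G \<Longrightarrow> src G u = u"
    and mul_closed: "(x, y) \<in> composable G \<Longrightarrow> mul G x y \<in> arrows G"
    and rng_mul: "(x, y) \<in> composable G \<Longrightarrow> rng G (mul G x y) = rng G x"
    and src_mul: "(x, y) \<in> composable G \<Longrightarrow> src G (mul G x y) = src G y"
    and mul_assoc: "\<lbrakk>(x, y) \<in> composable G; (y, z) \<in> composable G\<rbrakk>
          \<Longrightarrow> mul G (mul G x y) z = mul G x (mul G y z)"
    and unit_left: "x \<in> arrows G \<Longrightarrow> mul G (rng G x) x = x"
    and unit_right: "x \<in> arrows G \<Longrightarrow> mul G x (src G x) = x"
    and inv_closed: "x \<in> arrows G \<Longrightarrow> ginv G x \<in> arrows G"
    and rng_inv: "x \<in> arrows G \<Longrightarrow> rng G (ginv G x) = src G x"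
    and src_inv: "x \<in> arrows G \<Longrightarrow> src G (ginv G x) = rng G x"
    and inv_right: "x \<in> arrows G \<Longrightarrow> mul G x (ginv G x) = rng G x"
    and inv_left: "x \<in> arrows G \<Longrightarrow> mul G (ginv G x) x = src G x"
    and continuous_mul: "continuous_map
          (subtopology (prod_topology (gtop G) (gtop G)) (composable G)) (gtop G)
          (\<lambda>(x, y). mul G x y)"
    and continuous_inv: "continuous_map (gtop G) (gtop G) (ginv G)"
    and Hausdorff: "Hausdorff_space (gtop G)"
    and locally_compact: "locally_compact_space (gtop G)"
    and open_rng: "open_map (gtop G) (unit_space G) (rng G)"
    and open_src: "open_map (gtop G) (unit_space G) (src G)"

definition groupoid_hom :: "'g groupoid \<Rightarrow> 'h groupoid \<Rightarrow> ('g \<Rightarrow> 'h) \<Rightarrow> bool" where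
  "groupoid_hom G H f \<longleftrightarrow>
     f \<in> arrows G \<rightarrow> arrows H \<and>
     (\<forall>(x, y) \<in> composable G.
        (f x, f y) \<in> composable H \<and> f (mul G x y) = mul H (f x) (f y))"

section \<open>Actions\<close>

definition left_dom :: "'g groupoid \<Rightarrow> 'p topology \<Rightarrow> ('p \<Rightarrow> 'g) \<Rightarrow> ('g \<times> 'p) topology" where
  "left_dom G P \<rho> = subtopology (prod_topology (gtop G) P) {(g, p). src G g = \<rho> p}"

definition right_dom :: "'h groupoid \<Rightarrow> 'p topology \<Rightarrow> ('p \<Rightarrow> 'h) \<Rightarrow> ('p \<times> 'h) topology" where
  "right_dom H P \<sigma> = subtopology (prod_topology P (gtop H)) {(p, h). \<sigma> p = rng H h}"

definition left_action ::
  "'g groupoid \<Rightarrow> 'p topology \<Rightarrow> ('p \<Rightarrow> 'g) \<Rightarrow> ('g \<Rightarrow> 'p \<Rightarrow> 'p) \<Rightarrow> bool" where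
  "left_action G P \<rho> a \<longleftrightarrow>
     continuous_map P (unit_space G) \<rho> \<and>
     continuous_map (left_dom G P \<rho>) P (\<lambda>(g, p). a g p) \<and>
     (\<forall>(g, p) \<in> topspace (left_dom G P \<rho>). \<rho> (a g p) = rng G g) \<and>
     (\<forall>p \<in> topspace P. a (\<rho> p) p = p) \<and>
     (\<forall>g k p. (g, k) \<in> composable G \<longrightarrow> (k, p) \<in> topspace (left_dom G P \<rho>) \<longrightarrow>
        a g (a k p) = a (mul G g k) p)"

definition right_action ::
  "'h groupoid \<Rightarrow> 'p topology \<Rightarrow> ('p \<Rightarrow> 'h) \<Rightarrow> ('p \<Rightarrow> 'h \<Rightarrow> 'p) \<Rightarrow> bool" where
  "right_action H P \<sigma> b \<longleftrightarrow>
     continuous_map P (unit_space H) \<sigma> \<and>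
     continuous_map (right_dom H P \<sigma>) P (\<lambda>(p, h). b p h) \<and>
     (\<forall>(p, h) \<in> topspace (right_dom H P \<sigma>). \<sigma> (b p h) = src H h) \<and>
     (\<forall>p \<in> topspace P. b p (\<sigma> p) = p) \<and>
     (\<forall>p h k. (p, h) \<in> topspace (right_dom H P \<sigma>) \<longrightarrow> (h, k) \<in> composable H \<longrightarrow>
        b (b p h) k = b p (mul H h k))"

definition free_left ::
  "'g groupoid \<Rightarrow> 'p topology \<Rightarrow> ('p \<Rightarrow> 'g) \<Rightarrow> ('g \<Rightarrow> 'p \<Rightarrow> 'p) \<Rightarrow> bool" where
  "free_left G P \<rho> a \<longleftrightarrow>
     (\<forall>(g, p) \<in> topspace (left_dom G P \<rho>). a g p = p \<longrightarrow> g = \<rho> p)"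

definition free_right ::
  "'h groupoid \<Rightarrow> 'p topology \<Rightarrow> ('p \<Rightarrow> 'h) \<Rightarrow> ('p \<Rightarrow> 'h \<Rightarrow> 'p) \<Rightarrow> bool" where
  "free_right H P \<sigma> b \<longleftrightarrow>
     (\<forall>(p, h) \<in> topspace (right_dom H P \<sigma>). b p h = p \<longrightarrow> h = \<sigma> p)"

text \<open>
  Properness in the sense that preimages of compact sets are compact; the library's
  \<^const>\<open>proper_map\<close> asks for a closed map with compact fibres instead.
\<close>

definition compact_preimages :: "'a topology \<Rightarrow> 'b topology \<Rightarrow> ('a \<Rightarrow> 'b) \<Rightarrow> bool" where
  "compact_preimages X Y f \<longleftrightarrow>
     continuous_map X Y f \<and>
     (\<forall>K. compactin Y K \<longrightarrow> compactin X {x \<in> topspace X. f x \<in> K})"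

definition proper_left ::
  "'g groupoid \<Rightarrow> 'p topology \<Rightarrow> ('p \<Rightarrow> 'g) \<Rightarrow> ('g \<Rightarrow> 'p \<Rightarrow> 'p) \<Rightarrow> bool" where
  "proper_left G P \<rho> a \<longleftrightarrow>
     compact_preimages (left_dom G P \<rho>) (prod_topology P P) (\<lambda>(g, p). (a g p, p))"

definition proper_right ::
  "'h groupoid \<Rightarrow> 'p topology \<Rightarrow> ('p \<Rightarrow> 'h) \<Rightarrow> ('p \<Rightarrow> 'h \<Rightarrow> 'p) \<Rightarrow> bool" where
  "proper_right H P \<sigma> b \<longleftrightarrow>
     compact_preimages (right_dom H P \<sigma>) (prod_topology P P) (\<lambda>(p, h). (b p h, p))"

definition left_orbit ::
  "'g groupoid \<Rightarrow> ('p \<Rightarrow> 'g) \<Rightarrow> ('g \<Rightarrow> 'p \<Rightarrow> 'p) \<Rightarrow> 'p \<Rightarrow> 'p set" where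
  "left_orbit G \<rho> a p = {a g p | g. g \<in> arrows G \<and> src G g = \<rho> p}"

definition right_orbit ::
  "'h groupoid \<Rightarrow> ('p \<Rightarrow> 'h) \<Rightarrow> ('p \<Rightarrow> 'h \<Rightarrow> 'p) \<Rightarrow> 'p \<Rightarrow> 'p set" where
  "right_orbit H \<sigma> b p = {b p h | h. h \<in> arrows H \<and> \<sigma> p = rng H h}"

section \<open>Equivalences of groupoids\<close>

record ('g, 'h, 'z) bispace =
  ztop :: "'z topology"
  lmom :: "'z \<Rightarrow> 'g"
  rmom :: "'z \<Rightarrow> 'h"
  lact :: "'g \<Rightarrow> 'z \<Rightarrow> 'z"
  ract :: "'z \<Rightarrow> 'h \<Rightarrow> 'z"

definition points :: "('g, 'h, 'z) bispace \<Rightarrow> 'z set" where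
  "points Z = topspace (ztop Z)"

text \<open>
  The first two clauses say that both sides of the third are defined.
\<close>

definition actions_commute ::
  "'g groupoid \<Rightarrow> 'h groupoid \<Rightarrow> ('g, 'h, 'z) bispace \<Rightarrow> bool" where
  "actions_commute G H Z \<longleftrightarrow>
     (\<forall>z \<in> points Z. \<forall>g \<in> arrows G. src G g = lmom Z z \<longrightarrow>
        rmom Z (lact Z g z) = rmom Z z) \<and>
     (\<forall>z \<in> points Z. \<forall>h \<in> arrows H. rmom Z z = rng H h \<longrightarrow>
        lmom Z (ract Z z h) = lmom Z z) \<and>
     (\<forall>z \<in> points Z. \<forall>g \<in> arrows G. \<forall>h \<in> arrows H.
        src G g = lmom Z z \<longrightarrow> rmom Z z = rng H h \<longrightarrow>
        ract Z (lact Z g z) h = lact Z g (ract Z z h))"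

definition induces_homeomorphism ::
  "'z topology \<Rightarrow> ('z \<Rightarrow> 'b) \<Rightarrow> 'c topology \<Rightarrow> ('z \<Rightarrow> 'c) \<Rightarrow> bool" where
  "induces_homeomorphism X q Y f \<longleftrightarrow>
     (\<exists>\<phi>. homeomorphic_map (quotient_space X q) Y \<phi> \<and> (\<forall>x \<in> topspace X. \<phi> (q x) = f x))"

definition groupoid_equivalence ::
  "'g groupoid \<Rightarrow> 'h groupoid \<Rightarrow> ('g, 'h, 'z) bispace \<Rightarrow> bool" where
  "groupoid_equivalence G H Z \<longleftrightarrow>
     Hausdorff_space (ztop Z) \<and> locally_compact_space (ztop Z) \<and>
     left_action G (ztop Z) (lmom Z) (lact Z) \<and>
     free_left G (ztop Z) (lmom Z) (lact Z) \<and>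
     proper_left G (ztop Z) (lmom Z) (lact Z) \<and>
     right_action H (ztop Z) (rmom Z) (ract Z) \<and>
     free_right H (ztop Z) (rmom Z) (ract Z) \<and>
     proper_right H (ztop Z) (rmom Z) (ract Z) \<and>
     actions_commute G H Z \<and>
     open_map (ztop Z) (unit_space G) (lmom Z) \<and>
     induces_homeomorphism (ztop Z) (right_orbit H (rmom Z) (ract Z)) (unit_space G) (lmom Z) \<and>
     open_map (ztop Z) (unit_space H) (rmom Z) \<and>
     induces_homeomorphism (ztop Z) (left_orbit G (lmom Z) (lact Z)) (unit_space H) (rmom Z)"

text \<open>
  HOL cannot quantify over the type of points of \<open>Z\<close> inside a formula, but the type
  \<open>'g \<times> 'h\<close> is large enough for every equivalence: choose \<open>z\<^sub>u\<close> with \<open>lmom Z z\<^sub>u = u\<close> for each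
  \<open>u \<in> units G\<close>; since the right action is free and transitive on the fibres of the left moment
  map, each point is \<open>ract Z z\<^sub>u h\<close> for a unique pair \<open>(u, h)\<close> with \<open>rng H h = rmom Z z\<^sub>u\<close>, and the
  structure of \<open>Z\<close> can be transported along this injection into \<open>'g \<times> 'h\<close>.
\<close>

definition equivalent_groupoids :: "'g groupoid \<Rightarrow> 'h groupoid \<Rightarrow> bool" where
  "equivalent_groupoids G H \<longleftrightarrow>
     (\<exists>Z :: ('g, 'h, 'g \<times> 'h) bispace. groupoid_equivalence G H Z)"

section \<open>Twists\<close>

definition circle :: "complex set" where
  "circle = sphere 0 1"

text \<open>The product of the unit space, as a groupoid consisting of units only, with the circle.\<close>

definition circle_bundle :: "'g groupoid \<Rightarrow> ('g \<times> complex) groupoid" where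
  "circle_bundle G =
     \<lparr>gtop = prod_topology (unit_space G) (top_of_set circle),
      rng = (\<lambda>(u, t). (u, 1)),
      src = (\<lambda>(u, t). (u, 1)),
      mul = (\<lambda>(u, t) (v, w). (u, t * w)),
      ginv = (\<lambda>(u, t). (u, inverse t))\<rparr>"

text \<open>
  The unit spaces of \<open>E\<close> and \<open>G\<close> are different sets here, identified through \<open>j\<close>: a unit \<open>u\<close> of \<open>E\<close>
  corresponds to the unit \<open>j u\<close> of \<open>G\<close>.
\<close>

definition twist ::
  "'g groupoid \<Rightarrow> 'e groupoid \<Rightarrow> ('g \<times> complex \<Rightarrow> 'e) \<Rightarrow> ('e \<Rightarrow> 'g) \<Rightarrow> bool" where
  "twist G E \<iota> j \<longleftrightarrow>
     lch_groupoid G \<and> lch_groupoid E \<and>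
     groupoid_hom (circle_bundle G) E \<iota> \<and>
     continuous_map (gtop (circle_bundle G)) (gtop E) \<iota> \<and>
     groupoid_hom E G j \<and>
     continuous_map (gtop E) (gtop G) j \<and>
     embedding_map (gtop (circle_bundle G)) (gtop E) \<iota> \<and>
     open_map (gtop E) (gtop G) j \<and>
     j ` arrows E = arrows G \<and>
     homeomorphic_map (unit_space E) (unit_space G) j \<and>
     (\<forall>u \<in> units E. \<iota> (j u, 1) = u) \<and>
     {e \<in> arrows E. j e \<in> units G} = \<iota> ` arrows (circle_bundle G) \<and>
     (\<forall>e \<in> arrows E. \<forall>t \<in> circle.
        mul E (\<iota> (j (rng E e), t)) e = mul E e (\<iota> (j (src E e), t)))"

definition circle_lact ::
  "('g \<times> complex \<Rightarrow> 'e) \<Rightarrow> ('e \<Rightarrow> 'g) \<Rightarrow> ('e, 'f, 'z) bispace \<Rightarrow> complex \<Rightarrow> 'z \<Rightarrow> 'z" where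
  "circle_lact \<iota> j Z t z = lact Z (\<iota> (j (lmom Z z), t)) z"

definition circle_ract ::
  "('h \<times> complex \<Rightarrow> 'f) \<Rightarrow> ('f \<Rightarrow> 'h) \<Rightarrow> ('e, 'f, 'z) bispace \<Rightarrow> 'z \<Rightarrow> complex \<Rightarrow> 'z" where
  "circle_ract \<iota>' j' Z z t = ract Z z (\<iota>' (j' (rmom Z z), t))"

definition twist_equivalence ::
  "'e groupoid \<Rightarrow> ('g \<times> complex \<Rightarrow> 'e) \<Rightarrow> ('e \<Rightarrow> 'g) \<Rightarrow>
   'f groupoid \<Rightarrow> ('h \<times> complex \<Rightarrow> 'f) \<Rightarrow> ('f \<Rightarrow> 'h) \<Rightarrow> ('e, 'f, 'z) bispace \<Rightarrow> bool" where
  "twist_equivalence E \<iota> j E' \<iota>' j' Z \<longleftrightarrow>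
     groupoid_equivalence E E' Z \<and>
     (\<forall>t \<in> circle. \<forall>z \<in> points Z. circle_lact \<iota> j Z t z = circle_ract \<iota>' j' Z z t)"

definition circle_orbit ::
  "('g \<times> complex \<Rightarrow> 'e) \<Rightarrow> ('e \<Rightarrow> 'g) \<Rightarrow> ('e, 'f, 'z) bispace \<Rightarrow> 'z \<Rightarrow> 'z set" where
  "circle_orbit \<iota> j Z z = (\<lambda>t. circle_lact \<iota> j Z t z) ` circle"

text \<open>
  The quotient by the circle. The moment maps and actions are those determined by their values on
  representatives; composition with \<open>j\<close> and \<open>j'\<close> turns units of \<open>E\<close> and \<open>E'\<close> into units of \<open>G\<close> and
  \<open>G'\<close>.
\<close>

definition circle_quotient ::
  "'e groupoid \<Rightarrow> ('g \<times> complex \<Rightarrow> 'e) \<Rightarrow> ('e \<Rightarrow> 'g) \<Rightarrow> 'f groupoid \<Rightarrow> ('f \<Rightarrow> 'h) \<Rightarrow>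
   ('e, 'f, 'z) bispace \<Rightarrow> ('g, 'h, 'z set) bispace" where
  "circle_quotient E \<iota> j E' j' Z =
     (let cls = circle_orbit \<iota> j Z in
      \<lparr>ztop = quotient_space (ztop Z) cls,
       lmom = (\<lambda>c. THE u. \<exists>z \<in> points Z. c = cls z \<and> u = j (lmom Z z)),
       rmom = (\<lambda>c. THE v. \<exists>z \<in> points Z. c = cls z \<and> v = j' (rmom Z z)),
       lact = (\<lambda>g c. THE d. \<exists>e \<in> arrows E. \<exists>z \<in> points Z.
                 src E e = lmom Z z \<and> g = j e \<and> c = cls z \<and> d = cls (lact Z e z)),
       ract = (\<lambda>c h. THE d. \<exists>e \<in> arrows E'. \<exists>z \<in> points Z.
                 rmom Z z = rng E' e \<and> h = j' e \<and> c = cls z \<and> d = cls (ract Z z e))\<rparr>)"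

end

theory Submission
  imports Defs
begin

text \<open>
  The orbit map \<open>Z \<rightarrow> Z/T\<close> is open because \<open>T\<close> acts by homeomorphisms and proper because \<open>T\<close> is
  compact. Together with the open homomorphism \<open>j : E \<rightarrow> G\<close> it gives an open surjection from the
  domain of the action of \<open>E\<close> on \<open>Z\<close> onto that of \<open>G\<close> on \<open>Z/T\<close>, so continuity, properness and the
  identification of orbit spaces all pass to the quotient; freeness does because \<open>[e z] = [z]\<close> forces
  \<open>e\<close> into the image of \<open>\<iota>\<close>. The right action is the left action of the opposite groupoid. The same descent
  argument, applied to an injection of the space of points and to identity homomorphisms, transports
  an equivalence to the type \<open>'g \<times> 'h\<close> used in \<open>equivalent_groupoids\<close>.
\<close>

section \<open>Topological preliminaries\<close>

text \<open>Open boxes go to open boxes, so every point of an image has a box neighbourhood inside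
  it.\<close>

lemma open_map_prod:
  assumes f: "open_map X X' f" and g: "open_map Y Y' g"
  shows "open_map (prod_topology X Y) (prod_topology X' Y') (\<lambda>(x, y). (f x, g y))"
  unfolding open_map_def
proof (intro allI impI)
  fix W assume W: "openin (prod_topology X Y) W"
  show "openin (prod_topology X' Y') ((\<lambda>(x, y). (f x, g y)) ` W)"
    unfolding openin_prod_topology_alt
  proof (intro allI impI)
    fix x' y' assume "(x', y') \<in> (\<lambda>(x, y). (f x, g y)) ` W"
    then obtain x y where xy: "(x, y) \<in> W" "x' = f x" "y' = g y" by auto
    from W[unfolded openin_prod_topology_alt, rule_format, OF xy(1)]
    obtain U V where UV: "openin X U" "openin Y V" "x \<in> U" "y \<in> V" "U \<times> V \<subseteq> W"
      by blast
    then have "openin X' (f ` U)" "openin Y' (g ` V)" "x' \<in> f ` U" "y' \<in> g ` V"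
      using f g xy unfolding open_map_def by simp_all
    moreover have "f ` U \<times> g ` V \<subseteq> (\<lambda>(x, y). (f x, g y)) ` W"
      using UV(5) by force
    ultimately show "\<exists>U V. openin X' U \<and> openin Y' V \<and> x' \<in> U \<and> y' \<in> V \<and>
        U \<times> V \<subseteq> (\<lambda>(x, y). (f x, g y)) ` W"
      by blast
  qed
qed

text \<open>The diagonal of the target is the image of the diagonal of the source under \<open>\<pi> \<times> \<pi>\<close>.\<close>

lemma Hausdorff_space_perfect_map_image:
  assumes "Hausdorff_space X" and \<pi>: "perfect_map X Y \<pi>"
  shows "Hausdorff_space Y"
proof -
  have "closed_map (prod_topology X X) (prod_topology Y Y) (\<lambda>(x, y). (\<pi> x, \<pi> y))"
    using \<pi> by (simp add: perfect_map_def proper_imp_closed_map proper_map_prod)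
  moreover have "closedin (prod_topology X X) ((\<lambda>x. (x, x)) ` topspace X)"
    using assms by (simp add: Hausdorff_space_closedin_diagonal)
  ultimately have "closedin (prod_topology Y Y)
      ((\<lambda>(x, y). (\<pi> x, \<pi> y)) ` (\<lambda>x. (x, x)) ` topspace X)"
    by (simp add: closed_map_def)
  moreover have "(\<lambda>(x, y). (\<pi> x, \<pi> y)) ` (\<lambda>x. (x, x)) ` topspace X = (\<lambda>x. (x, x)) ` topspace Y"
    using \<pi> by (force simp: perfect_map_def)
  ultimately show ?thesis
    by (simp add: Hausdorff_space_closedin_diagonal)
qed

lemma open_map_from_surjection:
  assumes "continuous_map X Y \<pi>" "\<pi> ` topspace X = topspace Y"
    and "open_map X Z (f \<circ> \<pi>)"
  shows "open_map Y Z f"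
  by (metis assms open_map_from_composition_left)

text \<open>An injective quotient map is a homeomorphism, so the factor \<open>\<phi>\<close> can be
  eliminated: \<open>f\<close> must be a quotient map with the same fibres as \<open>q\<close>. Both
  conditions are easy to follow through a further quotient.\<close>

lemma induces_homeomorphism_iff:
  "induces_homeomorphism X q Y f \<longleftrightarrow>
     quotient_map X Y f \<and> (\<forall>x \<in> topspace X. \<forall>y \<in> topspace X. q x = q y \<longleftrightarrow> f x = f y)"
proof
  assume "induces_homeomorphism X q Y f"
  then obtain \<phi> where \<phi>: "homeomorphic_map (quotient_space X q) Y \<phi>"
    and f: "\<And>x. x \<in> topspace X \<Longrightarrow> \<phi> (q x) = f x"
    unfolding induces_homeomorphism_def by blast
  have "quotient_map X Y (\<phi> \<circ> q)"
    using \<phi> quotient_map_quotient_space quotient_map_compose homeomorphic_map_def by blast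
  then have "quotient_map X Y f"
    by (rule quotient_map_eq) (simp add: f)
  moreover have "inj_on \<phi> (q ` topspace X)"
    using \<phi> by (simp add: homeomorphic_map_def)
  ultimately show "quotient_map X Y f \<and>
      (\<forall>x \<in> topspace X. \<forall>y \<in> topspace X. q x = q y \<longleftrightarrow> f x = f y)"
    by (metis f imageI inj_on_def)
next
  assume *: "quotient_map X Y f \<and>
      (\<forall>x \<in> topspace X. \<forall>y \<in> topspace X. q x = q y \<longleftrightarrow> f x = f y)"
  then obtain \<phi> where \<phi>: "\<And>x. x \<in> topspace X \<Longrightarrow> f x = \<phi> (q x)"
    using function_factors_left_gen[of "\<lambda>x. x \<in> topspace X" q f] by auto
  have "quotient_map X Y (\<phi> \<circ> q)"
    by (rule quotient_map_eq[of _ _ f]) (use * \<phi> in auto)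
  then have "quotient_map (quotient_space X q) Y \<phi>"
    using quotient_map_compose_eq quotient_map_quotient_space by blast
  moreover have "inj_on \<phi> (q ` topspace X)"
    using * \<phi> by (auto simp: inj_on_def)
  ultimately show "induces_homeomorphism X q Y f"
    unfolding induces_homeomorphism_def homeomorphic_map_def using \<phi> by auto
qed

section \<open>Opposite groupoids\<close>

definition op_groupoid :: "'g groupoid \<Rightarrow> 'g groupoid" where
  "op_groupoid G = \<lparr>gtop = gtop G, rng = src G, src = rng G, mul = (\<lambda>x y. mul G y x), ginv = ginv G\<rparr>"

lemma op_groupoid_simps [simp]:
  "gtop (op_groupoid G) = gtop G" "rng (op_groupoid G) = src G" "src (op_groupoid G) = rng G"
  "mul (op_groupoid G) x y = mul G y x" "ginv (op_groupoid G) = ginv G"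
  "arrows (op_groupoid G) = arrows G"
  by (simp_all add: op_groupoid_def arrows_def)

lemma composable_op [simp]: "(x, y) \<in> composable (op_groupoid G) \<longleftrightarrow> (y, x) \<in> composable G"
  by (auto simp: composable_def)

lemma composable_iff:
  "(x, y) \<in> composable G \<longleftrightarrow> x \<in> arrows G \<and> y \<in> arrows G \<and> src G x = rng G y"
  by (simp add: composable_def)

context lch_groupoid
begin

lemma rng_units: "x \<in> arrows G \<Longrightarrow> rng G x \<in> units G"
  by (simp add: units_def)

text \<open>\<open>units\<close> is the image of the range map, so for the opposite groupoid it is
  the image of the source map. The images agree because every unit is its own source.\<close>

lemma units_op [simp]: "units (op_groupoid G) = units G"
proof -
  have "src G ` arrows G = units G"
    using src_units src_unit units_arrows by (metis image_subset_iff subset_antisym image_eqI subsetI)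
  then show ?thesis by (simp add: units_def)
qed

lemma unit_space_op [simp]: "unit_space (op_groupoid G) = unit_space G"
  by (simp add: unit_space_def)

lemma topspace_unit_space [simp]: "topspace (unit_space G) = units G"
  using units_arrows by (auto simp: unit_space_def arrows_def)

lemma lch_groupoid_op: "lch_groupoid (op_groupoid G)"
proof unfold_locales
  \<comment> \<open>Opposite multiplication is the original one after swapping coordinates; the
    remaining axioms are mirror images of each other.\<close>
  have "continuous_map (subtopology (prod_topology (gtop G) (gtop G)) (composable (op_groupoid G)))
      (subtopology (prod_topology (gtop G) (gtop G)) (composable G)) (\<lambda>(x, y). (y, x))"
    unfolding continuous_map_in_subtopology case_prod_unfold
    by (intro conjI continuous_map_from_subtopology continuous_intros) auto
  from continuous_map_compose[OF this continuous_mul]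
  show "continuous_map
     (subtopology (prod_topology (gtop (op_groupoid G)) (gtop (op_groupoid G)))
       (composable (op_groupoid G)))
     (gtop (op_groupoid G)) (\<lambda>(x, y). mul (op_groupoid G) x y)"
    by (simp add: o_def case_prod_unfold)
qed (simp_all add: src_units rng_units units_arrows rng_unit src_unit mul_closed rng_mul src_mul
    mul_assoc unit_left unit_right inv_closed rng_inv src_inv inv_right inv_left continuous_inv
    Hausdorff locally_compact open_rng open_src)

lemma unit_composable:
  "x \<in> arrows G \<Longrightarrow> (rng G x, x) \<in> composable G" "x \<in> arrows G \<Longrightarrow> (x, src G x) \<in> composable G"
  using rng_units src_units units_arrows rng_unit src_unit by (auto simp: composable_def)

end

section \<open>Right actions as left actions of the opposite groupoid\<close>

lemma topspace_left_dom:
  "(g, p) \<in> topspace (left_dom G P \<rho>) \<longleftrightarrow> g \<in> arrows G \<and> p \<in> topspace P \<and> src G g = \<rho> p"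
  by (auto simp: left_dom_def arrows_def)

lemma topspace_right_dom:
  "(p, h) \<in> topspace (right_dom H P \<sigma>) \<longleftrightarrow> p \<in> topspace P \<and> h \<in> arrows H \<and> \<sigma> p = rng H h"
  by (auto simp: right_dom_def arrows_def)

lemma ball_left_dom:
  "(\<forall>(g, p) \<in> topspace (left_dom G P \<rho>). Q g p) \<longleftrightarrow>
     (\<forall>g p. g \<in> arrows G \<and> p \<in> topspace P \<and> src G g = \<rho> p \<longrightarrow> Q g p)"
  unfolding Ball_def split_paired_All by (simp add: topspace_left_dom)

lemma ball_right_dom:
  "(\<forall>(p, h) \<in> topspace (right_dom H P \<sigma>). Q p h) \<longleftrightarrow>
     (\<forall>p h. p \<in> topspace P \<and> h \<in> arrows H \<and> \<sigma> p = rng H h \<longrightarrow> Q p h)"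
  unfolding Ball_def split_paired_All by (simp add: topspace_right_dom)

text \<open>The coordinate swap is continuous with continuous inverse. It carries continuity and
  compactness statements between the two kinds of domain.\<close>

lemma homeomorphic_map_right_dom_op:
  "homeomorphic_map (left_dom (op_groupoid H) P \<sigma>) (right_dom H P \<sigma>) (\<lambda>(h, p). (p, h))"
proof -
  have "continuous_map (left_dom (op_groupoid H) P \<sigma>) (right_dom H P \<sigma>) (\<lambda>(h, p). (p, h))"
    "continuous_map (right_dom H P \<sigma>) (left_dom (op_groupoid H) P \<sigma>) (\<lambda>(p, h). (h, p))"
    unfolding continuous_map_in_subtopology case_prod_unfold left_dom_def right_dom_def
    by (intro conjI continuous_map_from_subtopology continuous_intros; auto)+
  then show ?thesis
    unfolding homeomorphic_map_maps homeomorphic_maps_def by fastforce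
qed

text \<open>The swap is in particular a quotient map, so continuity can be tested after composing
  with it.\<close>

lemma continuous_map_right_dom_op:
  "continuous_map (right_dom H P \<sigma>) Y f \<longleftrightarrow>
   continuous_map (left_dom (op_groupoid H) P \<sigma>) Y (\<lambda>(h, p). f (p, h))"
  using continuous_compose_quotient_map_eq[of _ _ "\<lambda>(h, p). (p, h)" Y f]
    homeomorphic_map_right_dom_op[of H P \<sigma>]
  unfolding homeomorphic_map_def by (fastforce simp: o_def case_prod_unfold)

lemma right_action_op:
  assumes "lch_groupoid H"
  shows "right_action H P \<sigma> b \<longleftrightarrow> left_action (op_groupoid H) P \<sigma> (\<lambda>h p. b p h)"
  unfolding right_action_def left_action_def continuous_map_right_dom_op ball_left_dom ball_right_dom
    topspace_left_dom topspace_right_dom composable_iff lch_groupoid.unit_space_op[OF assms]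
    op_groupoid_simps split_conv
  by (intro iffI conjI; elim conjE; (assumption | metis))

lemma free_right_op:
  "free_right H P \<sigma> b \<longleftrightarrow> free_left (op_groupoid H) P \<sigma> (\<lambda>h p. b p h)"
  unfolding free_right_def free_left_def ball_left_dom ball_right_dom op_groupoid_simps
  by metis

text \<open>Both action maps list the moved point first and the original point second, so the swap
  of the domains matches their preimages of any \<open>K\<close>.\<close>

lemma proper_right_op:
  "proper_right H P \<sigma> b \<longleftrightarrow> proper_left (op_groupoid H) P \<sigma> (\<lambda>h p. b p h)"
proof -
  let ?L = "left_dom (op_groupoid H) P \<sigma>" and ?R = "right_dom H P \<sigma>"
  let ?s = "\<lambda>(h, p). (p, h)"
  have s: "homeomorphic_map ?L ?R ?s"
    by (rule homeomorphic_map_right_dom_op)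
  have "compactin ?R {x \<in> topspace ?R. (\<lambda>(p, h). (b p h, p)) x \<in> K} \<longleftrightarrow>
      compactin ?L {x \<in> topspace ?L. (\<lambda>(h, p). (b p h, p)) x \<in> K}" for K
  proof -
    have "?s ` {x \<in> topspace ?L. (\<lambda>(h, p). (b p h, p)) x \<in> K} =
        {x \<in> topspace ?R. (\<lambda>(p, h). (b p h, p)) x \<in> K}"
      by (force simp: topspace_left_dom topspace_right_dom image_iff)
    then show ?thesis
      using homeomorphic_map_compactness[OF s, of "{x \<in> topspace ?L. (\<lambda>(h, p). (b p h, p)) x \<in> K}"]
      by auto
  qed
  then show ?thesis
    unfolding proper_right_def proper_left_def compact_preimages_def continuous_map_right_dom_op
    by (auto simp: case_prod_unfold)
qed

lemma right_orbit_op: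
  "right_orbit H \<sigma> b p = left_orbit (op_groupoid H) \<sigma> (\<lambda>h p. b p h) p"
  by (auto simp: right_orbit_def left_orbit_def)

section \<open>Descent of actions along a quotient of groupoids\<close>

text \<open>Collects what the projection of a twist shares with an identity map, so that one descent
  argument serves both. The clause on unit spaces makes \<open>j\<close> injective on units, which
  lets moments be compared after applying \<open>j\<close>.\<close>

definition groupoid_quotient :: "'e groupoid \<Rightarrow> 'g groupoid \<Rightarrow> ('e \<Rightarrow> 'g) \<Rightarrow> bool" where
  "groupoid_quotient E G j \<longleftrightarrow>
     lch_groupoid E \<and> lch_groupoid G \<and> groupoid_hom E G j \<and>
     continuous_map (gtop E) (gtop G) j \<and> open_map (gtop E) (gtop G) j \<and>
     j ` arrows E = arrows G \<and> homeomorphic_map (unit_space E) (unit_space G) j"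

lemma groupoid_quotient_op:
  assumes "groupoid_quotient E G j"
  shows "groupoid_quotient (op_groupoid E) (op_groupoid G) j"
proof -
  have EG: "lch_groupoid E" "lch_groupoid G"
    using assms by (auto simp: groupoid_quotient_def)
  have "groupoid_hom (op_groupoid E) (op_groupoid G) j"
    using assms unfolding groupoid_quotient_def groupoid_hom_def Ball_def split_paired_All by simp
  with assms show ?thesis
    using EG
    by (simp add: groupoid_quotient_def lch_groupoid.lch_groupoid_op lch_groupoid.unit_space_op)
qed

lemma groupoid_quotient_id: "lch_groupoid G \<Longrightarrow> groupoid_quotient G G (\<lambda>x. x)"
  using open_map_id by (auto simp: groupoid_quotient_def groupoid_hom_def id_def
      homeomorphic_map_id[unfolded id_def])

locale quotient_of_groupoids =
  fixes E :: "'e groupoid" and G :: "'g groupoid" and j :: "'e \<Rightarrow> 'g"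
  assumes quotient: "groupoid_quotient E G j"
begin

sublocale E: lch_groupoid E using quotient by (simp add: groupoid_quotient_def)
sublocale G: lch_groupoid G using quotient by (simp add: groupoid_quotient_def)

lemma j_arrows: "e \<in> arrows E \<Longrightarrow> j e \<in> arrows G"
  using quotient by (auto simp: groupoid_quotient_def)

lemma j_surj: "g \<in> arrows G \<Longrightarrow> \<exists>e \<in> arrows E. g = j e"
  using quotient by (auto simp: groupoid_quotient_def)

lemma j_hom:
  assumes "(x, y) \<in> composable E"
  shows "(j x, j y) \<in> composable G" "j (mul E x y) = mul G (j x) (j y)"
  using quotient assms unfolding groupoid_quotient_def groupoid_hom_def by auto

lemma j_units: "u \<in> units E \<Longrightarrow> j u \<in> units G"
  using quotient unfolding groupoid_quotient_def homeomorphic_map_def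
  by (metis E.topspace_unit_space G.topspace_unit_space imageI quotient_imp_surjective_map)

lemma j_inj_units: "u \<in> units E \<Longrightarrow> v \<in> units E \<Longrightarrow> j u = j v \<longleftrightarrow> u = v"
  using quotient by (auto simp: groupoid_quotient_def homeomorphic_map_def inj_on_def)

text \<open>A homomorphism is only required to preserve composability and products. Applied to
  \<open>e\<close> followed by its source unit, this already forces sources to be preserved.\<close>

lemma src_j: "e \<in> arrows E \<Longrightarrow> src G (j e) = j (src E e)"
  using j_hom(1)[OF E.unit_composable(2)] j_units E.src_units G.rng_unit
  by (simp add: composable_iff)

lemma rng_j: "e \<in> arrows E \<Longrightarrow> rng G (j e) = j (rng E e)"
  using j_hom(1)[OF E.unit_composable(1)] j_units E.rng_units G.src_unit
  by (simp add: composable_iff)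

text \<open>Injectivity of \<open>j\<close> on units gives the converse of the homomorphism
  property, so composability lifts to arbitrary preimages.\<close>

lemma composable_j:
  "x \<in> arrows E \<Longrightarrow> y \<in> arrows E \<Longrightarrow> (j x, j y) \<in> composable G \<longleftrightarrow> (x, y) \<in> composable E"
  by (simp add: composable_iff src_j rng_j j_arrows j_inj_units E.src_units E.rng_units)

end

section \<open>Descent of a single left action\<close>

locale quotient_action = quotient_of_groupoids E G j
  for E :: "'e groupoid" and G :: "'g groupoid" and j :: "'e \<Rightarrow> 'g" +
  fixes P :: "'p topology" and \<rho> :: "'p \<Rightarrow> 'e" and a :: "'e \<Rightarrow> 'p \<Rightarrow> 'p"
  assumes action: "left_action E P \<rho> a"
begin

lemma \<rho>_units: "p \<in> topspace P \<Longrightarrow> \<rho> p \<in> units E"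
  using action unfolding left_action_def
  by (metis E.topspace_unit_space continuous_map_image_subset_topspace image_subset_iff)

lemma a_points: "\<lbrakk>e \<in> arrows E; p \<in> topspace P; src E e = \<rho> p\<rbrakk> \<Longrightarrow> a e p \<in> topspace P"
proof -
  assume *: "e \<in> arrows E" "p \<in> topspace P" "src E e = \<rho> p"
  have "(\<lambda>(g, p). a g p) ` topspace (left_dom E P \<rho>) \<subseteq> topspace P"
    using action unfolding left_action_def by (metis continuous_map_image_subset_topspace)
  moreover have "(e, p) \<in> topspace (left_dom E P \<rho>)"
    using * by (simp add: topspace_left_dom)
  ultimately show ?thesis by fastforce
qed

lemma \<rho>_a: "\<lbrakk>e \<in> arrows E; p \<in> topspace P; src E e = \<rho> p\<rbrakk> \<Longrightarrow> \<rho> (a e p) = rng E e"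
  using action unfolding left_action_def ball_left_dom by blast

lemma a_unit: "p \<in> topspace P \<Longrightarrow> a (\<rho> p) p = p"
  using action unfolding left_action_def by blast

lemma a_a:
  "\<lbrakk>e \<in> arrows E; f \<in> arrows E; src E e = rng E f; p \<in> topspace P; src E f = \<rho> p\<rbrakk>
    \<Longrightarrow> a e (a f p) = a (mul E e f) p"
  using action unfolding left_action_def topspace_left_dom composable_iff by simp

lemma self_in_orbit:
  assumes "p \<in> topspace P"
  shows "p \<in> left_orbit E \<rho> a p"
proof -
  have "\<rho> p \<in> arrows E" "src E (\<rho> p) = \<rho> p" "p = a (\<rho> p) p"
    using assms by (simp_all add: \<rho>_units E.units_arrows E.src_unit a_unit)
  then show ?thesis
    unfolding left_orbit_def by blast
qed

end

text \<open>The maps \<open>\<rho>'\<close> and \<open>a'\<close> are constrained only on images of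
  representatives, and nothing is assumed about their being an action. The map \<open>\<pi>\<close>
  may be a circle orbit map or a homeomorphism.\<close>

locale descended_action = quotient_action E G j P \<rho> a
  for E :: "'e groupoid" and G :: "'g groupoid" and j :: "'e \<Rightarrow> 'g"
    and P :: "'p topology" and \<rho> :: "'p \<Rightarrow> 'e" and a :: "'e \<Rightarrow> 'p \<Rightarrow> 'p" +
  fixes Q :: "'q topology" and \<rho>' :: "'q \<Rightarrow> 'g" and a' :: "'g \<Rightarrow> 'q \<Rightarrow> 'q"
    and \<pi> :: "'p \<Rightarrow> 'q"
  assumes perfect: "perfect_map P Q \<pi>"
    and open_\<pi>: "open_map P Q \<pi>"
    and moment: "p \<in> topspace P \<Longrightarrow> \<rho>' (\<pi> p) = j (\<rho> p)"
    and act: "\<lbrakk>e \<in> arrows E; p \<in> topspace P; src E e = \<rho> p\<rbrakk> \<Longrightarrow> a' (j e) (\<pi> p) = \<pi> (a e p)"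
begin

lemma \<pi>_surj: "c \<in> topspace Q \<Longrightarrow> \<exists>p \<in> topspace P. c = \<pi> p"
  and \<pi>_points: "p \<in> topspace P \<Longrightarrow> \<pi> p \<in> topspace Q"
  and continuous_\<pi>: "continuous_map P Q \<pi>"
  and proper_\<pi>: "proper_map P Q \<pi>"
  using perfect by (auto simp: perfect_map_def)

lemma quotient_\<pi>: "quotient_map P Q \<pi>"
  using perfect by (rule perfect_imp_quotient_map)

text \<open>Both sides compare units, on which \<open>j\<close> is injective. Hence any preimages of
  a matching pair match.\<close>

lemma moment_iff:
  "e \<in> arrows E \<Longrightarrow> p \<in> topspace P \<Longrightarrow> src G (j e) = \<rho>' (\<pi> p) \<longleftrightarrow> src E e = \<rho> p"
  by (simp add: src_j moment j_inj_units E.src_units \<rho>_units)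

lemma open_map_moment:
  assumes "open_map P (unit_space E) \<rho>"
  shows "open_map Q (unit_space G) \<rho>'"
proof (rule open_map_from_surjection[OF continuous_\<pi>])
  show "\<pi> ` topspace P = topspace Q"
    using perfect by (simp add: perfect_map_def)
  have "open_map (unit_space E) (unit_space G) j"
    using quotient by (simp add: groupoid_quotient_def homeomorphic_imp_open_map)
  with assms have "open_map P (unit_space G) (j \<circ> \<rho>)"
    by (rule open_map_compose)
  then show "open_map P (unit_space G) (\<rho>' \<circ> \<pi>)"
    by (rule open_map_eq) (simp add: moment)
qed

lemma continuous_moment: "continuous_map Q (unit_space G) \<rho>'"
proof (rule continuous_compose_quotient_map[OF quotient_\<pi>])
  have "continuous_map P (unit_space G) (j \<circ> \<rho>)"
    using action quotient unfolding left_action_def groupoid_quotient_def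
    by (blast intro: continuous_map_compose homeomorphic_imp_continuous_map)
  then show "continuous_map P (unit_space G) (\<rho>' \<circ> \<pi>)"
    by (rule continuous_map_eq) (simp add: moment)
qed

text \<open>
  The domain of the action of \<open>E\<close> is the full preimage of the domain of the action of \<open>G\<close>, so the
  open map \<open>j \<times> \<pi>\<close> restricts to an open map between the two.
\<close>

lemma quotient_map_left_dom:
  "quotient_map (left_dom E P \<rho>) (left_dom G Q \<rho>') (\<lambda>(e, p). (j e, \<pi> p))"
proof (rule continuous_open_imp_quotient_map)
  let ?V = "{(g, c). src G g = \<rho>' c}"
  have U: "{x \<in> topspace (prod_topology (gtop E) P). (\<lambda>(e, p). (j e, \<pi> p)) x \<in> ?V} =
      topspace (left_dom E P \<rho>)"
    by (auto simp: topspace_left_dom moment_iff simp flip: arrows_def)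
  \<comment> \<open>Cutting by the point set of the domain gives the form in which
    \<open>open_map_restriction\<close> describes the full preimage.\<close>
  have dom: "left_dom E P \<rho> = subtopology (prod_topology (gtop E) P) (topspace (left_dom E P \<rho>))"
    unfolding left_dom_def by (metis subtopology_restrict topspace_subtopology)
  have j: "open_map (gtop E) (gtop G) j" "continuous_map (gtop E) (gtop G) j"
    using quotient by (auto simp: groupoid_quotient_def)
  show "open_map (left_dom E P \<rho>) (left_dom G Q \<rho>') (\<lambda>(e, p). (j e, \<pi> p))"
    using open_map_restriction[OF open_map_prod[OF j(1) open_\<pi>] U]
    by (simp only: dom[symmetric] left_dom_def[of G, symmetric])
  show "(\<lambda>(e, p). (j e, \<pi> p)) ` topspace (left_dom E P \<rho>) = topspace (left_dom G Q \<rho>')"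
  proof (intro subset_antisym subsetI)
    fix x assume "x \<in> topspace (left_dom G Q \<rho>')"
    then obtain g c where gc: "x = (g, c)" "g \<in> arrows G" "c \<in> topspace Q" "src G g = \<rho>' c"
      by (metis surj_pair topspace_left_dom)
    then obtain e p where "g = j e" "e \<in> arrows E" "c = \<pi> p" "p \<in> topspace P"
      using j_surj \<pi>_surj by metis
    with gc show "x \<in> (\<lambda>(e, p). (j e, \<pi> p)) ` topspace (left_dom E P \<rho>)"
      by (intro image_eqI[of _ _ "(e, p)"]) (simp_all add: topspace_left_dom moment_iff)
  next
    fix x assume "x \<in> (\<lambda>(e, p). (j e, \<pi> p)) ` topspace (left_dom E P \<rho>)"
    then show "x \<in> topspace (left_dom G Q \<rho>')"
      by (auto simp: topspace_left_dom moment_iff j_arrows \<pi>_points)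
  qed
  have "(\<lambda>(e, p). (j e, \<pi> p)) \<in> topspace (left_dom E P \<rho>) \<rightarrow> ?V"
    by (auto simp: topspace_left_dom moment_iff)
  moreover have "continuous_map (left_dom E P \<rho>) (prod_topology (gtop G) Q) (\<lambda>(e, p). (j e, \<pi> p))"
    unfolding left_dom_def case_prod_unfold
    using continuous_map_compose[OF continuous_map_fst j(2)]
      continuous_map_compose[OF continuous_map_snd continuous_\<pi>]
    by (intro continuous_map_from_subtopology continuous_map_pairedI) (simp_all add: o_def)
  ultimately show "continuous_map (left_dom E P \<rho>) (left_dom G Q \<rho>') (\<lambda>(e, p). (j e, \<pi> p))"
    unfolding left_dom_def[of G] continuous_map_in_subtopology by (simp only: image_subset_iff_funcset)
qed

text \<open>Preimages of \<open>g\<close> and \<open>c\<close> are chosen independently and match by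
  \<open>moment_iff\<close>. This reduces each law for \<open>a'\<close> to representatives.\<close>

lemma left_domE:
  assumes "g \<in> arrows G" "c \<in> topspace Q" "src G g = \<rho>' c"
  obtains e p where "g = j e" "c = \<pi> p" "e \<in> arrows E" "p \<in> topspace P" "src E e = \<rho> p"
  using assms j_surj \<pi>_surj moment_iff by metis

lemma left_action_descends: "left_action G Q \<rho>' a'"
  unfolding left_action_def ball_left_dom topspace_left_dom
proof (intro conjI allI impI ballI; (elim conjE)?)
  show "continuous_map Q (unit_space G) \<rho>'"
    by (rule continuous_moment)
  \<comment> \<open>Continuity of \<open>a'\<close> is tested upstairs, along the quotient map
    between the two domains.\<close>
  have "continuous_map (left_dom E P \<rho>) Q (\<pi> \<circ> (\<lambda>(e, p). a e p))"
    using action continuous_\<pi> unfolding left_action_def by (blast intro: continuous_map_compose)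
  then have "continuous_map (left_dom E P \<rho>) Q ((\<lambda>(g, c). a' g c) \<circ> (\<lambda>(e, p). (j e, \<pi> p)))"
    by (rule continuous_map_eq) (auto simp: topspace_left_dom act)
  then show "continuous_map (left_dom G Q \<rho>') Q (\<lambda>(g, c). a' g c)"
    by (rule continuous_compose_quotient_map[OF quotient_map_left_dom])
next
  fix g c assume "g \<in> arrows G" "c \<in> topspace Q" "src G g = \<rho>' c"
  then obtain e p where "g = j e" "c = \<pi> p" "e \<in> arrows E" "p \<in> topspace P" "src E e = \<rho> p"
    by (elim left_domE)
  then show "\<rho>' (a' g c) = rng G g"
    by (simp add: act moment a_points \<rho>_a rng_j)
next
  fix c assume "c \<in> topspace Q"
  then obtain p where p: "c = \<pi> p" "p \<in> topspace P"
    using \<pi>_surj by blast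
  \<comment> \<open>The unit acting on \<open>c\<close> is \<open>j (\<rho> p)\<close>, so
    \<open>act\<close> is used with the arrow \<open>\<rho> p\<close>.\<close>
  with act[OF E.units_arrows[OF \<rho>_units], of p p] show "a' (\<rho>' c) c = c"
    by (simp add: a_unit moment \<rho>_units E.src_unit)
next
  fix g k c assume gk: "(g, k) \<in> composable G" and "k \<in> arrows G" "c \<in> topspace Q" "src G k = \<rho>' c"
  then obtain f p where fp: "k = j f" "c = \<pi> p" "f \<in> arrows E" "p \<in> topspace P" "src E f = \<rho> p"
    by (elim left_domE)
  obtain e where e: "g = j e" "e \<in> arrows E"
    using gk j_surj by (auto simp: composable_iff)
  have ef: "(e, f) \<in> composable E"
    using gk e fp by (simp add: composable_j)
  have "a' (j e) (\<pi> (a f p)) = \<pi> (a e (a f p))"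
    using ef e fp by (intro act) (simp_all add: a_points \<rho>_a composable_iff)
  moreover have "a' (j (mul E e f)) (\<pi> p) = \<pi> (a (mul E e f) p)"
    using ef fp by (intro act) (simp_all add: E.mul_closed E.src_mul)
  ultimately show "a' g (a' k c) = a' (mul G g k) c"
    using ef fp e by (simp add: act j_hom a_a composable_iff)
qed

text \<open>The hypothesis is freeness modulo \<open>\<pi>\<close>: an arrow that fixes only the
  class of \<open>p\<close> need not be a unit, but its image under \<open>j\<close> must
  be.\<close>

lemma free_left_descends:
  assumes "\<And>e p. \<lbrakk>e \<in> arrows E; p \<in> topspace P; src E e = \<rho> p; \<pi> (a e p) = \<pi> p\<rbrakk> \<Longrightarrow> j e = j (\<rho> p)"
  shows "free_left G Q \<rho>' a'"
  unfolding free_left_def ball_left_dom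
proof (intro allI impI, elim conjE)
  fix g c assume fixed: "a' g c = c" and "g \<in> arrows G" "c \<in> topspace Q" "src G g = \<rho>' c"
  then obtain e p where "g = j e" "c = \<pi> p" "e \<in> arrows E" "p \<in> topspace P" "src E e = \<rho> p"
    by (elim left_domE)
  with fixed show "g = \<rho>' c"
    by (simp add: act moment assms)
qed

text \<open>
  The preimage of \<open>K\<close> under the action map of \<open>G\<close> is the image under \<open>j \<times> \<pi>\<close> of the preimage of
  \<open>(\<pi> \<times> \<pi>)\<^sup>-\<^sup>1 K\<close> under the action map of \<open>E\<close>.
\<close>

lemma proper_left_descends:
  assumes "proper_left E P \<rho> a"
  shows "proper_left G Q \<rho>' a'"
  unfolding proper_left_def compact_preimages_def
proof (intro conjI allI impI)
  have "continuous_map (left_dom G Q \<rho>') Q (\<lambda>(g, c). a' g c)"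
    using left_action_descends by (simp add: left_action_def)
  moreover have "continuous_map (left_dom G Q \<rho>') Q snd"
    unfolding left_dom_def by (intro continuous_map_from_subtopology continuous_map_snd)
  ultimately show "continuous_map (left_dom G Q \<rho>') (prod_topology Q Q) (\<lambda>(g, c). (a' g c, c))"
    by (simp add: case_prod_unfold continuous_map_pairedI)
  fix K assume K: "compactin (prod_topology Q Q) K"
  let ?K' = "{x \<in> topspace (prod_topology P P). (\<lambda>(x, y). (\<pi> x, \<pi> y)) x \<in> K}"
  let ?L = "{x \<in> topspace (left_dom E P \<rho>). (\<lambda>(e, p). (a e p, p)) x \<in> ?K'}"
  \<comment> \<open>Properness of \<open>\<pi>\<close> in both coordinates is what keeps the
    pulled-back set compact.\<close>
  have "compactin (prod_topology P P) ?K'"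
    by (rule compactin_proper_map_preimage[OF _ K]) (simp add: proper_map_prod proper_\<pi>)
  then have "compactin (left_dom E P \<rho>) ?L"
    using assms unfolding proper_left_def compact_preimages_def by blast
  then have "compactin (left_dom G Q \<rho>') ((\<lambda>(e, p). (j e, \<pi> p)) ` ?L)"
    using quotient_imp_continuous_map[OF quotient_map_left_dom] by (rule image_compactin)
  moreover have "(\<lambda>(e, p). (j e, \<pi> p)) ` ?L =
      {x \<in> topspace (left_dom G Q \<rho>'). (\<lambda>(g, c). (a' g c, c)) x \<in> K}"
  proof (intro subset_antisym subsetI)
    fix x assume "x \<in> {x \<in> topspace (left_dom G Q \<rho>'). (\<lambda>(g, c). (a' g c, c)) x \<in> K}"
    then obtain g c where gc: "x = (g, c)" "g \<in> arrows G" "c \<in> topspace Q" "src G g = \<rho>' c"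
      "(a' g c, c) \<in> K"
      by (cases x) (auto simp: topspace_left_dom)
    obtain e p where ep: "g = j e" "c = \<pi> p" "e \<in> arrows E" "p \<in> topspace P" "src E e = \<rho> p"
      by (rule left_domE[OF gc(2-4)])
    with gc have "(e, p) \<in> ?L"
      by (simp add: topspace_left_dom a_points act)
    with gc ep show "x \<in> (\<lambda>(e, p). (j e, \<pi> p)) ` ?L"
      by (intro image_eqI[of _ _ "(e, p)"]) simp_all
  qed (auto simp: topspace_left_dom j_arrows \<pi>_points moment_iff act)
  ultimately show "compactin (left_dom G Q \<rho>')
      {x \<in> topspace (left_dom G Q \<rho>'). (\<lambda>(g, c). (a' g c, c)) x \<in> K}"
    by simp
qed

lemma left_orbit_descends:
  assumes "p \<in> topspace P"
  shows "left_orbit G \<rho>' a' (\<pi> p) = \<pi> ` left_orbit E \<rho> a p"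
proof (intro subset_antisym subsetI)
  fix d assume "d \<in> left_orbit G \<rho>' a' (\<pi> p)"
  then obtain g where g: "d = a' g (\<pi> p)" "g \<in> arrows G" "src G g = \<rho>' (\<pi> p)"
    by (auto simp: left_orbit_def)
  then obtain e where "g = j e" "e \<in> arrows E"
    using j_surj by blast
  with g assms show "d \<in> \<pi> ` left_orbit E \<rho> a p"
    by (auto simp: left_orbit_def act moment_iff)
next
  fix d assume "d \<in> \<pi> ` left_orbit E \<rho> a p"
  then obtain e where "d = \<pi> (a e p)" "e \<in> arrows E" "src E e = \<rho> p"
    by (auto simp: left_orbit_def)
  with assms show "d \<in> left_orbit G \<rho>' a' (\<pi> p)"
    by (auto simp: left_orbit_def act moment_iff j_arrows intro!: exI[of _ "j e"])
qed

text \<open>Here \<open>\<sigma>\<close> is the moment map of the other action and \<open>k\<close>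
  the quotient of its groupoid \<open>F\<close>. The composite of \<open>\<sigma>\<close> with
  \<open>k\<close> is a quotient map that factors through \<open>\<pi>\<close>, and its fibres are
  compared through orbits upstairs.\<close>

lemma induces_homeomorphism_descends:
  assumes \<sigma>: "induces_homeomorphism P (left_orbit E \<rho> a) (unit_space F) \<sigma>"
    and invariant: "\<And>e p. \<lbrakk>e \<in> arrows E; p \<in> topspace P; src E e = \<rho> p\<rbrakk> \<Longrightarrow> \<sigma> (a e p) = \<sigma> p"
    and F: "groupoid_quotient F H k"
    and \<sigma>': "\<And>p. p \<in> topspace P \<Longrightarrow> \<sigma>' (\<pi> p) = k (\<sigma> p)"
  shows "induces_homeomorphism Q (left_orbit G \<rho>' a') (unit_space H) \<sigma>'"
  unfolding induces_homeomorphism_iff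
proof (intro conjI ballI)
  interpret F: quotient_of_groupoids F H k
    using F by unfold_locales
  have quotient_\<sigma>: "quotient_map P (unit_space F) \<sigma>"
    and orbits: "\<And>p q. \<lbrakk>p \<in> topspace P; q \<in> topspace P\<rbrakk> \<Longrightarrow>
      left_orbit E \<rho> a p = left_orbit E \<rho> a q \<longleftrightarrow> \<sigma> p = \<sigma> q"
    using \<sigma> by (auto simp: induces_homeomorphism_iff)
  have \<sigma>_units: "\<sigma> p \<in> units F" if "p \<in> topspace P" for p
    using quotient_imp_surjective_map[OF quotient_\<sigma>] that by auto
  have "quotient_map P (unit_space H) (k \<circ> \<sigma>)"
    using quotient_\<sigma> F unfolding groupoid_quotient_def homeomorphic_map_def
    by (blast intro: quotient_map_compose)
  then have "quotient_map P (unit_space H) (\<sigma>' \<circ> \<pi>)"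
    by (rule quotient_map_eq) (simp add: \<sigma>')
  then show "quotient_map Q (unit_space H) \<sigma>'"
    by (simp add: quotient_map_compose_eq[OF quotient_\<pi>])
  fix c d assume "c \<in> topspace Q" "d \<in> topspace Q"
  then obtain p q where pq: "c = \<pi> p" "d = \<pi> q" "p \<in> topspace P" "q \<in> topspace P"
    using \<pi>_surj by metis
  show "left_orbit G \<rho>' a' c = left_orbit G \<rho>' a' d \<longleftrightarrow> \<sigma>' c = \<sigma>' d"
  proof
    assume "left_orbit G \<rho>' a' c = left_orbit G \<rho>' a' d"
    \<comment> \<open>Equal orbits downstairs give only equality modulo \<open>\<pi>\<close>, which
      suffices since \<open>\<sigma>'\<close> is evaluated on classes.\<close>
    then have "\<pi> p \<in> \<pi> ` left_orbit E \<rho> a q"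
      using pq self_in_orbit by (auto simp: left_orbit_descends)
    then obtain e where e: "\<pi> p = \<pi> (a e q)" "e \<in> arrows E" "src E e = \<rho> q"
      by (auto simp: left_orbit_def)
    then have "\<sigma>' (\<pi> p) = k (\<sigma> (a e q))"
      using pq by (simp add: \<sigma>' a_points)
    with e pq show "\<sigma>' c = \<sigma>' d"
      by (simp add: invariant \<sigma>')
  next
    assume "\<sigma>' c = \<sigma>' d"
    then have "\<sigma> p = \<sigma> q"
      using pq by (simp add: \<sigma>' F.j_inj_units \<sigma>_units)
    then have "left_orbit E \<rho> a p = left_orbit E \<rho> a q"
      using orbits pq by simp
    with pq show "left_orbit G \<rho>' a' c = left_orbit G \<rho>' a' d"
      by (simp add: left_orbit_descends)
  qed
qed

end

text \<open>Two instances of the one-sided descent, the second over opposite groupoids, handle the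
  two actions. Only their interaction and the topology of \<open>W\<close> remain; the Hausdorff
  property comes from perfectness of \<open>\<pi>\<close>, local compactness from its openness and
  continuity.\<close>

lemma groupoid_equivalence_descends:
  fixes Z :: "('e, 'f, 'z) bispace" and W :: "('g, 'h, 'w) bispace"
  assumes E: "groupoid_quotient E G j" and E': "groupoid_quotient E' G' j'"
    and Z: "groupoid_equivalence E E' Z"
    and perfect: "perfect_map (ztop Z) (ztop W) \<pi>" and "open_map (ztop Z) (ztop W) \<pi>"
    and lmom: "\<And>z. z \<in> points Z \<Longrightarrow> lmom W (\<pi> z) = j (lmom Z z)"
    and rmom: "\<And>z. z \<in> points Z \<Longrightarrow> rmom W (\<pi> z) = j' (rmom Z z)"
    and lact: "\<And>e z. \<lbrakk>e \<in> arrows E; z \<in> points Z; src E e = lmom Z z\<rbrakk>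
      \<Longrightarrow> lact W (j e) (\<pi> z) = \<pi> (lact Z e z)"
    and ract: "\<And>e z. \<lbrakk>e \<in> arrows E'; z \<in> points Z; rmom Z z = rng E' e\<rbrakk>
      \<Longrightarrow> ract W (\<pi> z) (j' e) = \<pi> (ract Z z e)"
    and lfree: "\<And>e z. \<lbrakk>e \<in> arrows E; z \<in> points Z; src E e = lmom Z z; \<pi> (lact Z e z) = \<pi> z\<rbrakk>
      \<Longrightarrow> j e = j (lmom Z z)"
    and rfree: "\<And>e z. \<lbrakk>e \<in> arrows E'; z \<in> points Z; rmom Z z = rng E' e; \<pi> (ract Z z e) = \<pi> z\<rbrakk>
      \<Longrightarrow> j' e = j' (rmom Z z)"
  shows "groupoid_equivalence G G' W"
proof -
  note Z_props = Z[unfolded groupoid_equivalence_def]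
  have gpd: "lch_groupoid E'" "lch_groupoid G'"
    using E' by (auto simp: groupoid_quotient_def)
  interpret L: descended_action E G j "ztop Z" "lmom Z" "lact Z" "ztop W" "lmom W" "lact W" \<pi>
    by unfold_locales (use Z_props assms in \<open>simp_all add: points_def\<close>)
  interpret R: descended_action "op_groupoid E'" "op_groupoid G'" j'
    "ztop Z" "rmom Z" "\<lambda>h z. ract Z z h" "ztop W" "rmom W" "\<lambda>h c. ract W c h" \<pi>
    by unfold_locales (use Z_props assms in
      \<open>simp_all add: points_def groupoid_quotient_op right_action_op[OF gpd(1), symmetric]\<close>)
  have commute: "actions_commute E E' Z"
    using Z_props by blast
  have rmom_inv: "rmom Z (lact Z e z) = rmom Z z"
    if "e \<in> arrows E" "z \<in> points Z" "src E e = lmom Z z" for e z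
    using commute that unfolding actions_commute_def by blast
  have lmom_inv: "lmom Z (ract Z z e) = lmom Z z"
    if "e \<in> arrows E'" "z \<in> points Z" "rmom Z z = rng E' e" for e z
    using commute that unfolding actions_commute_def by blast
  have lact_ract: "ract Z (lact Z e z) f = lact Z e (ract Z z f)"
    if "e \<in> arrows E" "f \<in> arrows E'" "z \<in> points Z" "src E e = lmom Z z" "rmom Z z = rng E' f" for e f z
    using commute that unfolding actions_commute_def by blast
  have lpoints: "lact Z e z \<in> points Z"
    if "e \<in> arrows E" "z \<in> points Z" "src E e = lmom Z z" for e z
    using that L.a_points by (simp add: points_def)
  have rpoints: "ract Z z e \<in> points Z"
    if "e \<in> arrows E'" "z \<in> points Z" "rmom Z z = rng E' e" for e z
    using that R.a_points by (simp add: points_def)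
  have lcases: "\<exists>e z. g = j e \<and> c = \<pi> z \<and> e \<in> arrows E \<and> z \<in> points Z \<and> src E e = lmom Z z"
    if "g \<in> arrows G" "c \<in> points W" "src G g = lmom W c" for g c
    using L.left_domE[of g c] that unfolding points_def by metis
  have rcases: "\<exists>e z. h = j' e \<and> c = \<pi> z \<and> e \<in> arrows E' \<and> z \<in> points Z \<and> rmom Z z = rng E' e"
    if "h \<in> arrows G'" "c \<in> points W" "rmom W c = rng G' h" for h c
    using R.left_domE[of h c] that unfolding points_def op_groupoid_simps by metis
  have "actions_commute G G' W"
    unfolding actions_commute_def
  proof (intro conjI ballI impI)
    fix c g assume "c \<in> points W" "g \<in> arrows G" "src G g = lmom W c"
    then obtain e z where "g = j e" "c = \<pi> z" "e \<in> arrows E" "z \<in> points Z" "src E e = lmom Z z"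
      using lcases by blast
    then show "rmom W (lact W g c) = rmom W c"
      by (simp add: lact rmom rmom_inv lpoints)
  next
    fix c h assume "c \<in> points W" "h \<in> arrows G'" "rmom W c = rng G' h"
    then obtain e z where "h = j' e" "c = \<pi> z" "e \<in> arrows E'" "z \<in> points Z" "rmom Z z = rng E' e"
      using rcases by blast
    then show "lmom W (ract W c h) = lmom W c"
      by (simp add: ract lmom lmom_inv rpoints)
  next
    fix c g h assume c: "c \<in> points W" and g: "g \<in> arrows G" "src G g = lmom W c"
      and h: "h \<in> arrows G'" "rmom W c = rng G' h"
    obtain e z where ez: "g = j e" "c = \<pi> z" "e \<in> arrows E" "z \<in> points Z" "src E e = lmom Z z"
      using lcases c g by blast
    obtain f where f: "h = j' f" "f \<in> arrows E'"
      using R.j_surj h by auto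
    \<comment> \<open>The representative \<open>z\<close> chosen for the left action also matches
      \<open>f\<close>, so both actions are computed on the same point.\<close>
    have "rmom Z z = rng E' f"
      using h ez f R.moment_iff[of f z] by (simp add: points_def)
    with ez f show "ract W (lact W g c) h = lact W g (ract W c h)"
      by (simp add: lact ract lpoints rpoints rmom_inv lmom_inv lact_ract)
  qed
  moreover have "Hausdorff_space (ztop W)"
    using Z_props perfect by (blast intro: Hausdorff_space_perfect_map_image)
  moreover have "locally_compact_space (ztop W)"
    using Z_props L.continuous_\<pi> L.open_\<pi> perfect unfolding perfect_map_def
    by (blast intro: locally_compact_space_continuous_open_map_image)
  moreover have "left_action G (ztop W) (lmom W) (lact W)"
    by (rule L.left_action_descends)
  moreover have "right_action G' (ztop W) (rmom W) (ract W)"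
    unfolding right_action_op[OF gpd(2)] by (rule R.left_action_descends)
  moreover have "free_left G (ztop W) (lmom W) (lact W)"
    by (rule L.free_left_descends) (simp add: lfree points_def)
  moreover have "free_right G' (ztop W) (rmom W) (ract W)"
    unfolding free_right_op by (rule R.free_left_descends) (simp add: rfree points_def)
  moreover have "proper_left G (ztop W) (lmom W) (lact W)"
    using Z_props by (intro L.proper_left_descends) blast
  moreover have "proper_right G' (ztop W) (rmom W) (ract W)"
    using Z_props unfolding proper_right_op by (intro R.proper_left_descends) blast
  moreover have "open_map (ztop W) (unit_space G) (lmom W)"
    using Z_props by (intro L.open_map_moment) blast
  moreover have "open_map (ztop W) (unit_space G') (rmom W)"
    using Z_props R.open_map_moment by (simp add: lch_groupoid.unit_space_op gpd)
  moreover have "induces_homeomorphism (ztop W) (right_orbit G' (rmom W) (ract W))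
      (unit_space G) (lmom W)"
    \<comment> \<open>Right orbits are the fibres of the left moment map, so the other groupoid in
      this instance is \<open>E\<close> with quotient \<open>G\<close>.\<close>
    unfolding right_orbit_op[abs_def]
    by (rule R.induces_homeomorphism_descends[OF _ _ E])
      (use Z_props in \<open>simp_all add: right_orbit_op[abs_def] lmom lmom_inv flip: points_def\<close>)
  moreover have "induces_homeomorphism (ztop W) (left_orbit G (lmom W) (lact W))
      (unit_space G') (rmom W)"
    by (rule L.induces_homeomorphism_descends[OF _ _ E'])
      (use Z_props in \<open>simp_all add: rmom rmom_inv flip: points_def\<close>)
  ultimately show ?thesis
    unfolding groupoid_equivalence_def by blast
qed

text \<open>A point is coded by its left moment and an arrow carrying a chosen base point to it.
  Transport along this code is descent along a homeomorphism with identity homomorphisms.\<close>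

lemma equivalent_groupoidsI:
  fixes Z :: "('g, 'h, 'z) bispace"
  assumes "lch_groupoid G" "lch_groupoid H" and Z: "groupoid_equivalence G H Z"
  shows "equivalent_groupoids G H"
proof -
  interpret H: quotient_action "op_groupoid H" "op_groupoid H" "\<lambda>h. h"
    "ztop Z" "rmom Z" "\<lambda>h z. ract Z z h"
    using assms by unfold_locales
      (simp_all add: groupoid_quotient_id groupoid_quotient_op groupoid_equivalence_def right_action_op)
  have orbits: "right_orbit H (rmom Z) (ract Z) z = right_orbit H (rmom Z) (ract Z) w"
    if "z \<in> points Z" "w \<in> points Z" "lmom Z z = lmom Z w" for z w
    using Z that unfolding groupoid_equivalence_def induces_homeomorphism_iff points_def by blast
  \<comment> \<open>The base point depends on \<open>u\<close> alone, so points with equal left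
    moments share it.\<close>
  define base where "base u = (SOME z. z \<in> points Z \<and> lmom Z z = u)" for u
  have base: "base (lmom Z z) \<in> points Z" "lmom Z (base (lmom Z z)) = lmom Z z"
    if "z \<in> points Z" for z
    using someI[of "\<lambda>w. w \<in> points Z \<and> lmom Z w = lmom Z z" z] that by (simp_all add: base_def)
  have "\<exists>h. z = ract Z (base (lmom Z z)) h" if z: "z \<in> points Z" for z
  proof -
    have "z \<in> right_orbit H (rmom Z) (ract Z) z"
      using H.self_in_orbit z by (simp add: right_orbit_op points_def)
    \<comment> \<open>Equal left moments mean equal right orbits, so the right action moves the base
      point to \<open>z\<close>.\<close>
    then have "z \<in> right_orbit H (rmom Z) (ract Z) (base (lmom Z z))"
      using orbits base z by metis
    then show ?thesis
      by (auto simp: right_orbit_def)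
  qed
  then obtain d where d: "\<And>z. z \<in> points Z \<Longrightarrow> z = ract Z (base (lmom Z z)) (d z)"
    by metis
  define \<pi> where "\<pi> z = (lmom Z z, d z)" for z
  \<comment> \<open>The first coordinate recovers the base point, and the second then recovers
    \<open>z\<close>, whichever arrow was chosen for it.\<close>
  have inj: "inj_on \<pi> (points Z)"
    by (rule inj_onI) (metis \<pi>_def d prod.inject)
  define rep where "rep = inv_into (points Z) \<pi>"
  have rep: "rep (\<pi> z) = z" if "z \<in> points Z" for z
    using inj that by (simp add: rep_def)
  \<comment> \<open>The structure is read through \<open>rep\<close>; its values outside the image
    of \<open>\<pi>\<close> are irrelevant to the descent equations.\<close>
  define W :: "('g, 'h, 'g \<times> 'h) bispace" where
    "W = \<lparr>ztop = quotient_space (ztop Z) \<pi>, lmom = lmom Z \<circ> rep, rmom = rmom Z \<circ> rep,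
          lact = (\<lambda>g c. \<pi> (lact Z g (rep c))), ract = (\<lambda>c h. \<pi> (ract Z (rep c) h))\<rparr>"
  have \<pi>: "homeomorphic_map (ztop Z) (ztop W) \<pi>"
    using inj by (simp add: homeomorphic_map_def W_def quotient_map_quotient_space points_def)
  have lfree: "g = lmom Z z"
    if "g \<in> arrows G" "z \<in> points Z" "src G g = lmom Z z" "lact Z g z = z" for g z
    using Z that unfolding groupoid_equivalence_def free_left_def ball_left_dom points_def by blast
  have rfree: "h = rmom Z z"
    if "h \<in> arrows H" "z \<in> points Z" "rmom Z z = rng H h" "ract Z z h = z" for h z
    using Z that unfolding groupoid_equivalence_def free_right_def ball_right_dom points_def by blast
  interpret G: quotient_action G G "\<lambda>g. g" "ztop Z" "lmom Z" "lact Z"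
    using assms by unfold_locales (simp_all add: groupoid_quotient_id groupoid_equivalence_def)
  have "groupoid_equivalence G H W"
  proof (rule groupoid_equivalence_descends[OF _ _ Z, where j = "\<lambda>g. g" and j' = "\<lambda>h. h"])
    show "groupoid_quotient G G (\<lambda>g. g)" "groupoid_quotient H H (\<lambda>h. h)"
      using assms by (simp_all add: groupoid_quotient_id)
    show "perfect_map (ztop Z) (ztop W) \<pi>" "open_map (ztop Z) (ztop W) \<pi>"
      using \<pi> by (simp_all add: homeomorphic_imp_perfect_map homeomorphic_imp_open_map)
    fix g z assume *: "g \<in> arrows G" "z \<in> points Z" "src G g = lmom Z z" "\<pi> (lact Z g z) = \<pi> z"
    then have "lact Z g z = z"
      using G.a_points[of g z] by (metis rep points_def)
    with * show "g = lmom Z z"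
      by (blast intro: lfree)
  next
    fix h z assume *: "h \<in> arrows H" "z \<in> points Z" "rmom Z z = rng H h" "\<pi> (ract Z z h) = \<pi> z"
    then have "ract Z z h = z"
      using H.a_points[of h z] by (metis rep op_groupoid_simps(3,6) points_def)
    with * show "h = rmom Z z"
      by (blast intro: rfree)
  qed (simp_all add: W_def rep)
  then show ?thesis
    unfolding equivalent_groupoids_def by blast
qed

section \<open>The circle action of a twist\<close>

lemma circle_mult: "s \<in> circle \<Longrightarrow> t \<in> circle \<Longrightarrow> s * t \<in> circle"
  and circle_inverse: "t \<in> circle \<Longrightarrow> inverse t \<in> circle"
  and circle_one: "1 \<in> circle"
  and circle_inverse_mult: "t \<in> circle \<Longrightarrow> inverse t * t = 1"
  by (auto simp: circle_def norm_mult norm_inverse intro!: left_inverse)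

lemma twist_imp_groupoid_quotient: "twist G E \<iota> j \<Longrightarrow> groupoid_quotient E G j"
  by (simp add: twist_def groupoid_quotient_def)

lemma circle_bundle_op: "lch_groupoid G \<Longrightarrow> circle_bundle (op_groupoid G) = circle_bundle G"
  by (simp add: circle_bundle_def lch_groupoid.unit_space_op)

lemma composable_circle_bundle:
  assumes "lch_groupoid G"
  shows "((u, s), (v, t)) \<in> composable (circle_bundle G) \<longleftrightarrow>
    u \<in> units G \<and> s \<in> circle \<and> t \<in> circle \<and> u = v"
  by (auto simp: composable_def arrows_def circle_bundle_def lch_groupoid.topspace_unit_space[OF assms])

lemma mul_circle_bundle: "mul (circle_bundle G) (u, s) (v, t) = (u, s * t)"
  by (simp add: circle_bundle_def)

text \<open>Commutativity of the circle keeps \<open>\<iota>\<close> a homomorphism after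
  multiplication is reversed, and the centrality law read from right to left is centrality for the
  opposite.\<close>

lemma twist_op:
  assumes "twist G E \<iota> j"
  shows "twist (op_groupoid G) (op_groupoid E) \<iota> j"
proof -
  have G: "lch_groupoid G" and E: "lch_groupoid E"
    and q: "groupoid_quotient (op_groupoid E) (op_groupoid G) j"
    using assms groupoid_quotient_op[OF twist_imp_groupoid_quotient[OF assms]]
    by (simp_all add: twist_def)
  have "groupoid_hom (circle_bundle G) (op_groupoid E) \<iota>"
    unfolding groupoid_hom_def
  proof (intro conjI ballI, goal_cases)
    case 1
    then show ?case
      using assms by (simp add: twist_def groupoid_hom_def)
  next
    case (2 x)
    then obtain u s t where x: "x = ((u, s), (u, t))" "u \<in> units G" "s \<in> circle" "t \<in> circle"
      by (cases x) (auto simp: composable_circle_bundle[OF G])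
    then have "((u, t), (u, s)) \<in> composable (circle_bundle G)"
      by (simp add: composable_circle_bundle[OF G])
    moreover have "groupoid_hom (circle_bundle G) E \<iota>"
      using assms by (simp add: twist_def)
    ultimately have "(\<iota> (u, t), \<iota> (u, s)) \<in> composable E"
      "\<iota> (u, t * s) = mul E (\<iota> (u, t)) (\<iota> (u, s))"
      unfolding groupoid_hom_def by (auto simp: mul_circle_bundle)
    with x show ?case
      by (simp add: mul_circle_bundle mult.commute)
  qed
  then show ?thesis
    using assms q
    unfolding twist_def groupoid_quotient_def circle_bundle_op[OF G] op_groupoid_simps
      lch_groupoid.units_op[OF E] lch_groupoid.units_op[OF G]
    by auto
qed

locale twisted_action = quotient_action E G j P \<rho> a
  for E :: "'e groupoid" and G :: "'g groupoid" and j :: "'e \<Rightarrow> 'g"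
    and P :: "'p topology" and \<rho> :: "'p \<Rightarrow> 'e" and a :: "'e \<Rightarrow> 'p \<Rightarrow> 'p" +
  fixes \<iota> :: "'g \<times> complex \<Rightarrow> 'e"
  assumes twist: "twist G E \<iota> j"
begin

lemma \<iota>_composable:
  assumes "u \<in> units E" "s \<in> circle" "t \<in> circle"
  shows "(\<iota> (j u, s), \<iota> (j u, t)) \<in> composable E"
    and "mul E (\<iota> (j u, s)) (\<iota> (j u, t)) = \<iota> (j u, s * t)"
proof -
  have "((j u, s), (j u, t)) \<in> composable (circle_bundle G)"
    using assms by (simp add: composable_circle_bundle G.lch_groupoid_axioms j_units)
  then show "(\<iota> (j u, s), \<iota> (j u, t)) \<in> composable E"
    and "mul E (\<iota> (j u, s)) (\<iota> (j u, t)) = \<iota> (j u, s * t)"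
    using twist unfolding twist_def groupoid_hom_def by (auto simp: mul_circle_bundle)
qed

lemma \<iota>_one: "u \<in> units E \<Longrightarrow> \<iota> (j u, 1) = u"
  using twist by (simp add: twist_def)

lemma \<iota>_arrows: "u \<in> units E \<Longrightarrow> t \<in> circle \<Longrightarrow> \<iota> (j u, t) \<in> arrows E"
  using \<iota>_composable(1) by (auto simp: composable_iff)

text \<open>The scalar \<open>1\<close> over \<open>u\<close> is \<open>u\<close> itself, and it is
  composable with every scalar over \<open>u\<close>.\<close>

lemma rng_\<iota>: "u \<in> units E \<Longrightarrow> t \<in> circle \<Longrightarrow> rng E (\<iota> (j u, t)) = u"
  using \<iota>_composable(1)[OF _ circle_one] by (simp add: \<iota>_one composable_iff E.src_unit)

lemma src_\<iota>: "u \<in> units E \<Longrightarrow> t \<in> circle \<Longrightarrow> src E (\<iota> (j u, t)) = u"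
  using \<iota>_composable(1)[OF _ _ circle_one] by (simp add: \<iota>_one composable_iff E.rng_unit)

lemma kernel: "{e \<in> arrows E. j e \<in> units G} = \<iota> ` (units G \<times> circle)"
  using twist unfolding twist_def arrows_def[of "circle_bundle G"] by (simp add: circle_bundle_def)

text \<open>The kernel condition says only that the image is some unit. Being its own source, it is
  identified by \<open>src_j\<close> and \<open>src_\<iota>\<close>.\<close>

lemma j_\<iota>: "u \<in> units E \<Longrightarrow> t \<in> circle \<Longrightarrow> j (\<iota> (j u, t)) = j u"
proof -
  assume *: "u \<in> units E" "t \<in> circle"
  then have "j (\<iota> (j u, t)) \<in> units G"
    using kernel j_units by blast
  then have "j (\<iota> (j u, t)) = src G (j (\<iota> (j u, t)))"
    by (simp add: G.src_unit)
  with * show ?thesis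
    by (simp add: src_j \<iota>_arrows src_\<iota>)
qed

lemma kernelE:
  assumes "e \<in> arrows E" "j e \<in> units G"
  obtains u t where "u \<in> units E" "t \<in> circle" "e = \<iota> (j u, t)"
proof -
  obtain v t where vt: "v \<in> units G" "t \<in> circle" "e = \<iota> (v, t)"
    using assms kernel by blast
  moreover obtain u where "u \<in> units E" "v = j u"
    using quotient vt(1) unfolding groupoid_quotient_def homeomorphic_map_def
    by (metis E.topspace_unit_space G.topspace_unit_space imageE quotient_imp_surjective_map)
  ultimately show thesis
    using that by blast
qed

lemma central:
  "e \<in> arrows E \<Longrightarrow> t \<in> circle \<Longrightarrow> mul E (\<iota> (j (rng E e), t)) e = mul E e (\<iota> (j (src E e), t))"
  using twist by (simp add: twist_def)

lemma \<iota>_mul: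
  assumes "e \<in> arrows E" "t \<in> circle"
  shows "mul E (\<iota> (j (rng E e), t)) e \<in> arrows E"
    and "src E (mul E (\<iota> (j (rng E e), t)) e) = src E e"
    and "j (mul E (\<iota> (j (rng E e), t)) e) = j e"
proof -
  have c: "(\<iota> (j (rng E e), t), e) \<in> composable E"
    using assms by (simp add: composable_iff \<iota>_arrows src_\<iota> E.rng_units)
  then show "mul E (\<iota> (j (rng E e), t)) e \<in> arrows E"
    "src E (mul E (\<iota> (j (rng E e), t)) e) = src E e"
    by (simp_all add: E.mul_closed E.src_mul)
  have "j (mul E (\<iota> (j (rng E e), t)) e) = mul G (j (rng E e)) (j e)"
    using c assms by (simp add: j_hom j_\<iota> E.rng_units)
  also have "\<dots> = j e"
    using assms G.unit_left[of "j e"] by (simp add: j_arrows rng_j)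
  finally show "j (mul E (\<iota> (j (rng E e), t)) e) = j e" .
qed

text \<open>The product of \<open>f\<close> with the inverse of \<open>e\<close> maps to a unit, so
  it is a scalar. Fibres of \<open>j\<close> are thus single circle orbits.\<close>

lemma j_eqE:
  assumes "e \<in> arrows E" "f \<in> arrows E" "j e = j f"
  obtains t where "t \<in> circle" "f = mul E (\<iota> (j (rng E e), t)) e"
proof -
  have se: "src E f = src E e" and re: "rng E f = rng E e"
    using assms src_j rng_j j_inj_units E.src_units E.rng_units by metis+
  let ?k = "mul E f (ginv E e)"
  have c: "(f, ginv E e) \<in> composable E" "(ginv E e, e) \<in> composable E"
    using assms se by (simp_all add: composable_iff E.inv_closed E.rng_inv E.src_inv)
  have c': "(e, ginv E e) \<in> composable E"
    using assms by (simp add: composable_iff E.inv_closed E.rng_inv)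
  have "j ?k = j (mul E e (ginv E e))"
    using c c' assms by (simp add: j_hom)
  also have "\<dots> \<in> units G"
    using assms by (simp add: E.inv_right j_units E.rng_units)
  finally obtain u t where ut: "u \<in> units E" "t \<in> circle" "?k = \<iota> (j u, t)"
    using kernelE c(1) E.mul_closed by metis
  have "u = rng E e"
    using ut c(1) re E.rng_mul rng_\<iota> by metis
  moreover have "mul E ?k e = f"
    using c assms se E.unit_right[of f] by (simp add: E.mul_assoc E.inv_left)
  ultimately show thesis
    using that ut by metis
qed

text \<open>Defined for a one-sided action, this becomes \<open>circle_lact\<close> for the left
  action and \<open>circle_ract\<close> for the opposite of the right one.\<close>

definition rot :: "complex \<Rightarrow> 'p \<Rightarrow> 'p" where
  "rot t p = a (\<iota> (j (\<rho> p), t)) p"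

definition orb :: "'p \<Rightarrow> 'p set" where
  "orb p = (\<lambda>t. rot t p) ` circle"

lemma rot_points: "t \<in> circle \<Longrightarrow> p \<in> topspace P \<Longrightarrow> rot t p \<in> topspace P"
  by (simp add: rot_def a_points \<iota>_arrows src_\<iota> \<rho>_units)

lemma \<rho>_rot: "t \<in> circle \<Longrightarrow> p \<in> topspace P \<Longrightarrow> \<rho> (rot t p) = \<rho> p"
  by (simp add: rot_def \<rho>_a \<iota>_arrows src_\<iota> rng_\<iota> \<rho>_units)

lemma rot_rot:
  "s \<in> circle \<Longrightarrow> t \<in> circle \<Longrightarrow> p \<in> topspace P \<Longrightarrow> rot s (rot t p) = rot (s * t) p"
  \<comment> \<open>Only the outer rotation is unfolded first, so that its moment simplifies to
    \<open>\<rho> p\<close> and both scalars lie over the same unit.\<close>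
  unfolding rot_def[of s "rot t p"]
  by (simp add: \<rho>_rot) (simp add: rot_def a_a \<iota>_arrows src_\<iota> rng_\<iota> \<rho>_units \<iota>_composable)

lemma rot_one: "p \<in> topspace P \<Longrightarrow> rot 1 p = p"
  by (simp add: rot_def \<iota>_one \<rho>_units a_unit)

text \<open>A rotation after \<open>e\<close> is absorbed into the arrow as a scalar on its left;
  centrality moves that scalar to the right, where it rotates \<open>p\<close>.\<close>

lemma rot_a:
  assumes "e \<in> arrows E" "p \<in> topspace P" "src E e = \<rho> p" "t \<in> circle"
  shows "rot t (a e p) = a (mul E (\<iota> (j (rng E e), t)) e) p" and "a e (rot t p) = rot t (a e p)"
proof -
  show *: "rot t (a e p) = a (mul E (\<iota> (j (rng E e), t)) e) p"
    using assms by (simp add: rot_def \<rho>_a a_a \<iota>_arrows src_\<iota> E.rng_units)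
  have "a e (rot t p) = a (mul E e (\<iota> (j (src E e), t))) p"
    using assms by (simp add: rot_def a_a \<iota>_arrows src_\<iota> rng_\<iota> \<rho>_units)
  with * show "a e (rot t p) = rot t (a e p)"
    using assms by (simp add: central)
qed

section \<open>Circle orbits and the topology of the orbit map\<close>

lemma orb_eq_iff:
  assumes "p \<in> topspace P" "q \<in> topspace P"
  shows "orb p = orb q \<longleftrightarrow> (\<exists>t \<in> circle. p = rot t q)"
proof
  assume "orb p = orb q"
  moreover have "p \<in> orb p"
    unfolding orb_def by (rule image_eqI[OF _ circle_one]) (simp add: rot_one assms)
  ultimately show "\<exists>t \<in> circle. p = rot t q"
    by (auto simp: orb_def)
next
  have sub: "orb (rot t q) \<subseteq> orb q" if "t \<in> circle" "q \<in> topspace P" for t q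
    using that by (auto simp: orb_def rot_rot circle_mult)
  assume "\<exists>t \<in> circle. p = rot t q"
  then obtain t where t: "t \<in> circle" "p = rot t q" by blast
  then have "q = rot (inverse t) p"
    using assms by (simp add: rot_rot circle_inverse circle_inverse_mult rot_one)
  with t sub[of t q] sub[of "inverse t" p] assms show "orb p = orb q"
    by (auto simp: circle_inverse)
qed

text \<open>The scalar \<open>\<iota> (j (\<rho> p), t)\<close> depends continuously on
  \<open>t\<close> and \<open>p\<close>; pairing it with \<open>p\<close> lands in the domain of the
  continuous action.\<close>

lemma continuous_rot: "continuous_map (prod_topology (top_of_set circle) P) P (\<lambda>(t, p). rot t p)"
proof -
  let ?X = "prod_topology (top_of_set circle) P"
  have \<rho>: "continuous_map P (unit_space E) \<rho>"
    using action by (simp add: left_action_def)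
  have "continuous_map (unit_space E) (unit_space G) j"
    using quotient by (simp add: groupoid_quotient_def homeomorphic_imp_continuous_map)
  then have "continuous_map ?X (unit_space G) (j \<circ> (\<rho> \<circ> snd))"
    using \<rho> by (intro continuous_map_compose[where X' = "unit_space E"]
        continuous_map_compose[where X' = P] continuous_map_snd)
  then have "continuous_map ?X (prod_topology (unit_space G) (top_of_set circle))
      (\<lambda>x. (j (\<rho> (snd x)), fst x))"
    by (intro continuous_map_pairedI continuous_map_fst) (simp add: o_def)
  moreover have "continuous_map (prod_topology (unit_space G) (top_of_set circle)) (gtop E) \<iota>"
    using twist by (simp add: twist_def circle_bundle_def)
  ultimately have "continuous_map ?X (gtop E) (\<iota> \<circ> (\<lambda>x. (j (\<rho> (snd x)), fst x)))"
    by (rule continuous_map_compose)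
  then have "continuous_map ?X (prod_topology (gtop E) P) (\<lambda>x. (\<iota> (j (\<rho> (snd x)), fst x), snd x))"
    by (intro continuous_map_pairedI continuous_map_snd) (simp add: o_def)
  then have "continuous_map ?X (left_dom E P \<rho>) (\<lambda>x. (\<iota> (j (\<rho> (snd x)), fst x), snd x))"
    unfolding left_dom_def continuous_map_in_subtopology by (auto simp: src_\<iota> \<rho>_units)
  moreover have "continuous_map (left_dom E P \<rho>) P (\<lambda>(g, p). a g p)"
    using action by (simp add: left_action_def)
  ultimately have "continuous_map ?X P
      ((\<lambda>(g, p). a g p) \<circ> (\<lambda>x. (\<iota> (j (\<rho> (snd x)), fst x), snd x)))"
    by (rule continuous_map_compose)
  then show ?thesis
    by (simp add: rot_def o_def case_prod_unfold)
qed

text \<open>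
  Saturations are projections along the compact factor \<open>circle\<close>, and such projections are both open
  and closed.
\<close>

lemma saturation:
  assumes "S \<subseteq> topspace P"
  shows "{p \<in> topspace P. orb p \<in> orb ` S} =
    snd ` {x \<in> topspace (prod_topology (top_of_set circle) P). (\<lambda>(t, p). rot t p) x \<in> S}"
proof -
  have "orb p \<in> orb ` S \<longleftrightarrow> (\<exists>t \<in> circle. rot t p \<in> S)" if "p \<in> topspace P" for p
  proof
    assume "orb p \<in> orb ` S"
    then obtain q where "q \<in> S" "orb q = orb p" by auto
    then show "\<exists>t \<in> circle. rot t p \<in> S"
      using assms that orb_eq_iff by blast
  next
    assume "\<exists>t \<in> circle. rot t p \<in> S"
    then obtain t where "t \<in> circle" "rot t p \<in> S" by blast
    moreover from this have "orb p = orb (rot t p)"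
      using orb_eq_iff that rot_points by metis
    ultimately show "orb p \<in> orb ` S" by blast
  qed
  then have "{p \<in> topspace P. orb p \<in> orb ` S} =
      {p \<in> topspace P. \<exists>t \<in> circle. rot t p \<in> S}"
    by blast
  also have "\<dots> = snd ` {x \<in> circle \<times> topspace P. (\<lambda>(t, p). rot t p) x \<in> S}"
    by (auto simp: image_iff)
  finally show ?thesis
    by simp
qed

lemma open_map_orb: "open_map P (quotient_space P orb) orb"
  unfolding open_map_def
proof (intro allI impI)
  fix U assume U: "openin P U"
  then have "openin (prod_topology (top_of_set circle) P)
      {x \<in> topspace (prod_topology (top_of_set circle) P). (\<lambda>(t, p). rot t p) x \<in> U}"
    using continuous_rot by (rule openin_continuous_map_preimage[rotated])
  then have "openin P {p \<in> topspace P. orb p \<in> orb ` U}"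
    using open_map_snd openin_subset[OF U] unfolding open_map_def saturation[OF openin_subset[OF U]]
    by blast
  with openin_subset[OF U] show "openin (quotient_space P orb) (orb ` U)"
    unfolding openin_quotient_space by blast
qed

lemma closed_map_orb: "closed_map P (quotient_space P orb) orb"
  unfolding closed_map_def
proof (intro allI impI)
  fix C assume C: "closedin P C"
  \<comment> \<open>Compactness of the circle makes the projection to \<open>P\<close>
    closed.\<close>
  have "compact_space (top_of_set circle)"
    by (simp add: circle_def compact_space_subtopology compactin_euclidean_iff)
  then have "closed_map (prod_topology (top_of_set circle) P) P snd"
    by (rule closed_map_snd)
  moreover have "closedin (prod_topology (top_of_set circle) P)
      {x \<in> topspace (prod_topology (top_of_set circle) P). (\<lambda>(t, p). rot t p) x \<in> C}"
    using continuous_rot C by (rule closedin_continuous_map_preimage)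
  ultimately have "closedin P {p \<in> topspace P. orb p \<in> orb ` C}"
    unfolding closed_map_def saturation[OF closedin_subset[OF C]] by blast
  moreover have "orb ` C \<subseteq> topspace (quotient_space P orb)"
    using closedin_subset[OF C] by auto
  ultimately show "closedin (quotient_space P orb) (orb ` C)"
    using quotient_map_quotient_space[of P orb] unfolding quotient_map_closedin by blast
qed

text \<open>The fibres are circle orbits, hence continuous images of a compact set; with closedness
  this gives properness.\<close>

lemma perfect_map_orb: "perfect_map P (quotient_space P orb) orb"
proof -
  have "compactin P {q \<in> topspace P. orb q = orb p}" if p: "p \<in> topspace P" for p
  proof -
    have "{q \<in> topspace P. orb q = orb p} = (\<lambda>t. rot t p) ` circle"
      using p orb_eq_iff rot_points by blast
    moreover have "continuous_map (top_of_set circle) P ((\<lambda>(t, p). rot t p) \<circ> (\<lambda>t. (t, p)))"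
      using p
      by (intro continuous_map_compose[OF _ continuous_rot] continuous_map_pairedI) simp_all
    then have "continuous_map (top_of_set circle) P (\<lambda>t. rot t p)"
      by (simp add: o_def)
    moreover have "compactin (top_of_set circle) circle"
      by (simp add: circle_def compactin_subtopology compactin_euclidean_iff)
    ultimately show ?thesis
      using image_compactin by metis
  qed
  then have "proper_map P (quotient_space P orb) orb"
    unfolding proper_map_def using closed_map_orb by auto
  then show ?thesis
    using quotient_imp_continuous_map[OF quotient_map_quotient_space]
    by (simp add: perfect_map_def)
qed

section \<open>Independence of representatives, and freeness modulo the circle\<close>

lemma orb_moment:
  assumes "p \<in> topspace P" "q \<in> topspace P" "orb p = orb q"
  shows "\<rho> p = \<rho> q"
proof -
  obtain t where "t \<in> circle" "p = rot t q"
    using assms orb_eq_iff by blast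
  with assms show ?thesis
    by (simp add: \<rho>_rot)
qed

text \<open>The arrows differ by a scalar \<open>s\<close> and the points by a rotation
  \<open>t\<close>. Both pull out of the action, so the results differ by the rotation
  \<open>t * s\<close>.\<close>

lemma orb_act:
  assumes e: "e \<in> arrows E" "p \<in> topspace P" "src E e = \<rho> p"
    and f: "f \<in> arrows E" "q \<in> topspace P" "src E f = \<rho> q"
    and eq: "j e = j f" "orb p = orb q"
  shows "orb (a e p) = orb (a f q)"
proof -
  obtain t where t: "t \<in> circle" "p = rot t q"
    using eq e f orb_eq_iff by blast
  obtain s where s: "s \<in> circle" "e = mul E (\<iota> (j (rng E f), s)) f"
    using j_eqE[OF f(1) e(1) eq(1)[symmetric]] .
  have src: "src E e = \<rho> q"
    using e f t \<rho>_rot by simp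
  have "a e p = rot t (a e q)"
    using rot_a(2)[of e q t] e f t src by simp
  also have "a e q = rot s (a f q)"
    using rot_a(1)[of f q s] f s by simp
  finally have "a e p = rot (t * s) (a f q)"
    using s t f by (simp add: rot_rot a_points)
  then show ?thesis
    using orb_eq_iff[of "a e p" "a f q"] a_points e f s t circle_mult by blast
qed

text \<open>The rotation taking \<open>a e p\<close> back to \<open>p\<close> is absorbed into
  \<open>e\<close> without changing \<open>j e\<close>. The resulting arrow fixes \<open>p\<close>,
  so freeness makes it the unit \<open>\<rho> p\<close>.\<close>

lemma orb_free:
  assumes free: "free_left E P \<rho> a"
    and e: "e \<in> arrows E" "p \<in> topspace P" "src E e = \<rho> p" and "orb (a e p) = orb p"
  shows "j e = j (\<rho> p)"
proof -
  obtain t where t: "t \<in> circle" "p = rot t (a e p)"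
    using assms orb_eq_iff a_points by metis
  let ?e = "mul E (\<iota> (j (rng E e), t)) e"
  have "a ?e p = p"
    using t e rot_a(1)[of e p t] by simp
  then have "?e = \<rho> p"
    using free e t \<iota>_mul unfolding free_left_def ball_left_dom by metis
  then show ?thesis
    using \<iota>_mul(3) e t by metis
qed

end

section \<open>The circle quotient of a twist equivalence\<close>

theorem proposition6p4:
  fixes G :: "'g groupoid" and E :: "'e groupoid"
    and G' :: "'h groupoid" and E' :: "'f groupoid"
    and \<iota> :: "'g \<times> complex \<Rightarrow> 'e" and j :: "'e \<Rightarrow> 'g"
    and \<iota>' :: "'h \<times> complex \<Rightarrow> 'f" and j' :: "'f \<Rightarrow> 'h"
    and Z :: "('e, 'f, 'z) bispace"
  assumes "twist G E \<iota> j"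
    and "twist G' E' \<iota>' j'"
    and "twist_equivalence E \<iota> j E' \<iota>' j' Z"
  shows "(let cls = circle_orbit \<iota> j Z; Z\<^sub>T = circle_quotient E \<iota> j E' j' Z in
           (\<forall>z \<in> points Z. cls z = (\<lambda>t. circle_ract \<iota>' j' Z z t) ` circle) \<and>
           (\<forall>z \<in> points Z. lmom Z\<^sub>T (cls z) = j (lmom Z z)) \<and>
           (\<forall>z \<in> points Z. rmom Z\<^sub>T (cls z) = j' (rmom Z z)) \<and>
           (\<forall>e \<in> arrows E. \<forall>z \<in> points Z. src E e = lmom Z z \<longrightarrow>
              lact Z\<^sub>T (j e) (cls z) = cls (lact Z e z)) \<and>
           (\<forall>e' \<in> arrows E'. \<forall>z \<in> points Z. rmom Z z = rng E' e' \<longrightarrow>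
              ract Z\<^sub>T (cls z) (j' e') = cls (ract Z z e')) \<and>
           groupoid_equivalence G G' Z\<^sub>T) \<and>
         equivalent_groupoids G G'"
proof -
  let ?cls = "circle_orbit \<iota> j Z" and ?W = "circle_quotient E \<iota> j E' j' Z"
  have Z: "groupoid_equivalence E E' Z"
    using assms(3) by (simp add: twist_equivalence_def)
  note Z_props = Z[unfolded groupoid_equivalence_def]
  have gpd: "lch_groupoid G" "lch_groupoid G'" "lch_groupoid E'"
    using assms by (simp_all add: twist_def)
  have quotients: "groupoid_quotient E G j" "groupoid_quotient E' G' j'"
    using assms by (simp_all add: twist_imp_groupoid_quotient)
  interpret L: twisted_action E G j "ztop Z" "lmom Z" "lact Z" \<iota>
    by unfold_locales (use Z_props assms quotients in simp_all)
  interpret R: twisted_action "op_groupoid E'" "op_groupoid G'" j' "ztop Z" "rmom Z" "\<lambda>h z. ract Z z h" \<iota>'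
    by unfold_locales (use Z_props assms quotients in
      \<open>simp_all add: groupoid_quotient_op twist_op right_action_op[OF gpd(3), symmetric]\<close>)
  have orb: "L.orb = ?cls"
    by (simp add: fun_eq_iff L.orb_def L.rot_def circle_orbit_def circle_lact_def)
  have circle_actions: "(\<lambda>t. circle_ract \<iota>' j' Z z t) ` circle = ?cls z" if "z \<in> points Z" for z
    using assms(3) that unfolding twist_equivalence_def circle_orbit_def
    by (intro image_cong) auto
  \<comment> \<open>Agreement of the two circle actions gives both sides the same classes, so facts
    about right circle orbits apply to \<open>?cls\<close>.\<close>
  have orb': "R.orb z = ?cls z" if "z \<in> points Z" for z
    using circle_actions[OF that] by (simp add: R.orb_def R.rot_def circle_ract_def)
  have lmom: "lmom ?W (?cls z) = j (lmom Z z)" if z: "z \<in> points Z" for z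
  proof -
    have "lmom ?W (?cls z) = (THE u. \<exists>w \<in> points Z. ?cls z = ?cls w \<and> u = j (lmom Z w))"
      by (simp add: circle_quotient_def Let_def)
    also have "\<dots> = j (lmom Z z)"
    \<comment> \<open>Uniqueness here is independence of the representative, supplied by
      \<open>L.orb_moment\<close>.\<close>
    proof (rule the_equality)
      fix u assume "\<exists>w \<in> points Z. ?cls z = ?cls w \<and> u = j (lmom Z w)"
      then obtain w where w: "w \<in> points Z" "?cls z = ?cls w" "u = j (lmom Z w)" by blast
      then show "u = j (lmom Z z)"
        using z L.orb_moment[of z w] by (simp add: orb points_def)
    qed (use z in blast)
    finally show ?thesis .
  qed
  have rmom: "rmom ?W (?cls z) = j' (rmom Z z)" if z: "z \<in> points Z" for z
  proof -
    have "rmom ?W (?cls z) = (THE v. \<exists>w \<in> points Z. ?cls z = ?cls w \<and> v = j' (rmom Z w))"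
      by (simp add: circle_quotient_def Let_def)
    also have "\<dots> = j' (rmom Z z)"
    proof (rule the_equality)
      fix v assume "\<exists>w \<in> points Z. ?cls z = ?cls w \<and> v = j' (rmom Z w)"
      then obtain w where w: "w \<in> points Z" "?cls z = ?cls w" "v = j' (rmom Z w)" by blast
      then show "v = j' (rmom Z z)"
        using z R.orb_moment[of z w] by (simp add: orb' flip: points_def)
    qed (use z in blast)
    finally show ?thesis .
  qed
  have lact: "lact ?W (j e) (?cls z) = ?cls (lact Z e z)"
    if ez: "e \<in> arrows E" "z \<in> points Z" "src E e = lmom Z z" for e z
  proof -
    have "lact ?W (j e) (?cls z) = (THE d. \<exists>f \<in> arrows E. \<exists>w \<in> points Z.
        src E f = lmom Z w \<and> j e = j f \<and> ?cls z = ?cls w \<and> d = ?cls (lact Z f w))"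
      by (simp add: circle_quotient_def Let_def)
    also have "\<dots> = ?cls (lact Z e z)"
    \<comment> \<open>The description ranges over all lifts of the arrow and of the class;
      \<open>L.orb_act\<close> shows that they give one value.\<close>
    proof (rule the_equality)
      fix d assume "\<exists>f \<in> arrows E. \<exists>w \<in> points Z.
        src E f = lmom Z w \<and> j e = j f \<and> ?cls z = ?cls w \<and> d = ?cls (lact Z f w)"
      then obtain f w where "f \<in> arrows E" "w \<in> points Z" "src E f = lmom Z w" "j e = j f"
        "?cls z = ?cls w" "d = ?cls (lact Z f w)" by blast
      then show "d = ?cls (lact Z e z)"
        using ez L.orb_act[of e z f w] by (simp add: orb points_def)
    qed (use ez in blast)
    finally show ?thesis .
  qed
  have rpoints: "ract Z z e \<in> points Z"
    if "e \<in> arrows E'" "z \<in> points Z" "rmom Z z = rng E' e" for e z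
    using that R.a_points by (simp add: points_def)
  have ract: "ract ?W (?cls z) (j' e) = ?cls (ract Z z e)"
    if ez: "e \<in> arrows E'" "z \<in> points Z" "rmom Z z = rng E' e" for e z
  proof -
    have "ract ?W (?cls z) (j' e) = (THE d. \<exists>f \<in> arrows E'. \<exists>w \<in> points Z.
        rmom Z w = rng E' f \<and> j' e = j' f \<and> ?cls z = ?cls w \<and> d = ?cls (ract Z w f))"
      by (simp add: circle_quotient_def Let_def)
    also have "\<dots> = ?cls (ract Z z e)"
    proof (rule the_equality)
      fix d assume "\<exists>f \<in> arrows E'. \<exists>w \<in> points Z.
        rmom Z w = rng E' f \<and> j' e = j' f \<and> ?cls z = ?cls w \<and> d = ?cls (ract Z w f)"
      then obtain f w where "f \<in> arrows E'" "w \<in> points Z" "rmom Z w = rng E' f" "j' e = j' f"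
        "?cls z = ?cls w" "d = ?cls (ract Z w f)" by blast
      then show "d = ?cls (ract Z z e)"
        using ez R.orb_act[of e z f w] by (simp add: orb' rpoints flip: points_def)
    qed (use ez in blast)
    finally show ?thesis .
  qed
  have W: "groupoid_equivalence G G' ?W"
  proof (rule groupoid_equivalence_descends[OF quotients Z, where \<pi> = ?cls])
    have ztop: "ztop ?W = quotient_space (ztop Z) ?cls"
      by (simp add: circle_quotient_def Let_def)
    show "perfect_map (ztop Z) (ztop ?W) ?cls"
      using L.perfect_map_orb by (simp add: ztop orb)
    show "open_map (ztop Z) (ztop ?W) ?cls"
      using L.open_map_orb by (simp add: ztop orb)
  next
    fix e z assume "e \<in> arrows E" "z \<in> points Z" "src E e = lmom Z z" "?cls (lact Z e z) = ?cls z"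
    then show "j e = j (lmom Z z)"
      using Z_props L.orb_free[of e z] by (simp add: orb points_def)
  next
    fix e z assume *: "e \<in> arrows E'" "z \<in> points Z" "rmom Z z = rng E' e" "?cls (ract Z z e) = ?cls z"
    \<comment> \<open>The classes are rewritten as right circle orbits, so that
      \<open>R.orb_free\<close> can use freeness of the right action.\<close>
    then have "R.orb (ract Z z e) = R.orb z"
      by (simp add: orb' rpoints)
    with * show "j' e = j' (rmom Z z)"
      using Z_props R.orb_free[of e z] by (simp add: free_right_op points_def)
  qed (simp_all add: lmom rmom lact ract)
  then have "equivalent_groupoids G G'"
    using gpd by (intro equivalent_groupoidsI)
  with W show ?thesis
    unfolding Let_def using circle_actions lmom rmom lact ract by auto
qed

end
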